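(* Let $K$ be a field, $S=K[x_1,\ldots,x_n]$, and let $I\subset S$ be a proper graded ideal. If $\operatorname{depth} F(I)>0$, then $\mu(I^k)\leq \mu(I^{k+1})$ for all integers $k\geq 0$. If in addition $\operatorname{height} I\geq 2$, then $\mu(I^k)<\mu(I^{k+1})$ for all integers $k\geq 0$.
   Context: $S$ is standard graded with graded maximal ideal $\mathfrak{m}=(x_1,\ldots,x_n)$. For a graded ideal $L$, $\mu(L)$ is the minimal number of generators of $L$ (and $I^0=S$, $\mu(S)=1$). The fiber ring of $I$ is the standard graded $K$-algebra $F(I)=\bigoplus_{k\geq 0}I^k/\mathfrak{m}I^k$; its depth is taken with respect to its graded maximal ideal. *)

theory Defs
  imports
    "HOL-Algebra.Algebra"
    "HOL-Algebra.Algebraic_Closure_Type"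
    "HOL-Library.Poly_Mapping"
    "HOL-Library.Extended_Nat"
begin

section \<open>Ideals in a commutative ring\<close>

abbreviation ideal_power :: "('a, 'b) ring_scheme \<Rightarrow> 'a set \<Rightarrow> nat \<Rightarrow> 'a set"
  where "ideal_power R I k \<equiv> I [^]\<^bsub>ideals_set R\<^esub> k"

text \<open>
  This is meaningful for finitely generated \<open>L\<close> only; in a Noetherian ring, such as a polynomial
  ring in finitely many variables over a field, that is every ideal.
\<close>
definition min_num_gens :: "('a, 'b) ring_scheme \<Rightarrow> 'a set \<Rightarrow> nat"
  where "min_num_gens R L =
    (LEAST m. \<exists>A \<subseteq> carrier R. finite A \<and> card A = m \<and> Idl\<^bsub>R\<^esub> A = L)"

definition prime_height :: "('a, 'b) ring_scheme \<Rightarrow> 'a set \<Rightarrow> enat"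
  where "prime_height R P =
    (SUP r \<in> {r :: nat. \<exists>Q. (\<forall>i\<le>r. primeideal (Q i) R) \<and> (\<forall>i<r. Q i \<subset> Q (Suc i)) \<and> Q r = P}.
       enat r)"

definition height :: "('a, 'b) ring_scheme \<Rightarrow> 'a set \<Rightarrow> enat"
  where "height R I = (INF P \<in> {P. primeideal P R \<and> I \<subseteq> P}. prime_height R P)"

definition regular_sequence :: "('a, 'b) ring_scheme \<Rightarrow> 'a list \<Rightarrow> bool"
  where "regular_sequence R xs \<longleftrightarrow>
    set xs \<subseteq> carrier R \<and>
    (\<forall>i < length xs. \<forall>r \<in> carrier R.
       xs ! i \<otimes>\<^bsub>R\<^esub> r \<in> Idl\<^bsub>R\<^esub> (set (take i xs)) \<longrightarrow> r \<in> Idl\<^bsub>R\<^esub> (set (take i xs))) \<and>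
    Idl\<^bsub>R\<^esub> (set xs) \<noteq> carrier R"

text \<open>The depth of \<open>R\<close>, as a module over itself, with respect to the ideal \<open>M\<close>.\<close>
definition depth :: "('a, 'b) ring_scheme \<Rightarrow> 'a set \<Rightarrow> enat"
  where "depth R M = (SUP xs \<in> {xs. regular_sequence R xs \<and> set xs \<subseteq> M}. enat (length xs))"


section \<open>The fiber ring\<close>

text \<open>
  An element of the direct sum of the \<open>I\<^sup>k / M I\<^sup>k\<close> is a finitely supported family \<open>f\<close> of cosets,
  where \<open>f k\<close> is a coset of \<open>M I\<^sup>k\<close> with a representative in \<open>I\<^sup>k\<close>. So \<open>I\<^sup>k / M I\<^sup>k\<close> is regarded as
  a subgroup of \<open>R / M I\<^sup>k\<close>, and sums of cosets are formed in that quotient ring. The product of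
  \<open>a + M I\<^sup>i\<close> and \<open>b + M I\<^sup>j\<close> is \<open>a b + M I\<^sup>i\<^sup>+\<^sup>j\<close>; as \<^const>\<open>rcoset_mult\<close> unites the cosets of the
  products of all representatives, it yields this coset also when its two arguments are cosets
  of different ideals.
\<close>

definition fiber_ring :: "('a, 'b) ring_scheme \<Rightarrow> 'a set \<Rightarrow> 'a set \<Rightarrow> (nat \<Rightarrow> 'a set) ring"
  where "fiber_ring R M I =
    (let J = (\<lambda>k. M \<cdot>\<^bsub>R\<^esub> ideal_power R I k) in
      \<lparr>carrier = {f. (\<forall>k. \<exists>a \<in> ideal_power R I k. f k = J k +>\<^bsub>R\<^esub> a) \<and> finite {k. f k \<noteq> J k}},
       monoid.mult = (\<lambda>f g k. \<Oplus>\<^bsub>R Quot J k\<^esub>i\<in>{..k}. rcoset_mult R (J k) (f i) (g (k - i))),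
       one = (\<lambda>k. if k = 0 then J 0 +>\<^bsub>R\<^esub> \<one>\<^bsub>R\<^esub> else J k),
       ring.zero = J,
       add = (\<lambda>f g k. f k \<oplus>\<^bsub>R Quot J k\<^esub> g k)\<rparr>)"

text \<open>The sum of the components of positive degree: the graded maximal ideal if \<open>R / M\<close> is a field.\<close>
definition fiber_ring_plus :: "('a, 'b) ring_scheme \<Rightarrow> 'a set \<Rightarrow> 'a set \<Rightarrow> (nat \<Rightarrow> 'a set) set"
  where "fiber_ring_plus R M I =
    {f \<in> carrier (fiber_ring R M I). f 0 = \<zero>\<^bsub>fiber_ring R M I\<^esub> 0}"


section \<open>The standard graded polynomial ring in \<open>n\<close> variables\<close>

text \<open>
  The variables are indexed by \<open>0, \<dots>, n - 1\<close>. A monomial is its finitely supported exponent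
  function, and a polynomial maps monomials to coefficients.
\<close>
definition mpoly_ring :: "nat \<Rightarrow> ((nat \<Rightarrow>\<^sub>0 nat) \<Rightarrow>\<^sub>0 'k::field) ring"
  where "mpoly_ring n =
    ring_of_type_algebra\<lparr>carrier := {p. \<forall>t \<in> Poly_Mapping.keys p. Poly_Mapping.keys t \<subseteq> {..<n}}\<rparr>"

definition mpoly_var :: "nat \<Rightarrow> (nat \<Rightarrow>\<^sub>0 nat) \<Rightarrow>\<^sub>0 'k::field"
  where "mpoly_var i = Poly_Mapping.single (Poly_Mapping.single i 1) 1"

definition graded_max :: "nat \<Rightarrow> ((nat \<Rightarrow>\<^sub>0 nat) \<Rightarrow>\<^sub>0 'k::field) set"
  where "graded_max n = Idl\<^bsub>mpoly_ring n\<^esub> (mpoly_var ` {..<n})"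

definition homogeneous :: "nat \<Rightarrow> ((nat \<Rightarrow>\<^sub>0 nat) \<Rightarrow>\<^sub>0 'k::field) \<Rightarrow> bool"
  where "homogeneous d p \<longleftrightarrow> (\<forall>t \<in> Poly_Mapping.keys p. (\<Sum>i\<in>Poly_Mapping.keys t. Poly_Mapping.lookup t i) = d)"

definition graded_ideal :: "nat \<Rightarrow> ((nat \<Rightarrow>\<^sub>0 nat) \<Rightarrow>\<^sub>0 'k::field) set \<Rightarrow> bool"
  where "graded_ideal n I \<longleftrightarrow>
    (\<exists>A \<subseteq> carrier (mpoly_ring n). (\<forall>a \<in> A. \<exists>d. homogeneous d a) \<and> I = Idl\<^bsub>mpoly_ring n\<^esub> A)"

end

theory Submission
  imports Defs "Jordan_Normal_Form.Determinant"
begin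

text \<open>
  Write \<open>S\<close> for the polynomial ring, \<open>\<mm>\<close> for its graded maximal ideal, \<open>F\<close> for the fiber ring, and
  \<open>F\<^sub>k = I\<^sup>k / \<mm>I\<^sup>k\<close>. By the graded Nakayama lemma, \<open>\<mu>(I\<^sup>k)\<close> is the dimension of \<open>F\<^sub>k\<close>
  (lemmas \<open>min_homog_gens_relation\<close> and \<open>min_num_gens_eq\<close>).

  Positive depth provides a nonzerodivisor in \<open>F\<^sub>+\<close>, so no nonzero element of \<open>F\<^sub>k\<close> is annihilated by
  \<open>I\<close> (\<open>depth_pos_socle\<close>). Over an infinite field one would now choose a nonzerodivisor in \<open>F\<^sub>1\<close>. Over
  an arbitrary field its role is taken by the generic element \<open>f = \<Sum>\<^sub>i x\<^sub>i t\<^sup>i \<in> S[t]\<close>, where the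
  \<open>x\<^sub>i\<close> generate \<open>I\<close>: McCoy's argument on zero divisors in polynomial rings shows that multiplication
  by \<open>f\<close> is injective from \<open>F\<^sub>k[t]\<close> to \<open>F\<^sub>k\<^sub>+\<^sub>1[t]\<close> (\<open>mccoy\<close>).

  Take minimal generators \<open>b\<^sub>1, \<dots>, b\<^sub>r\<close> of \<open>I\<^sup>k\<close> and \<open>e\<^sub>1, \<dots>, e\<^sub>s\<close> of \<open>I\<^sup>k\<^sup>+\<^sup>1\<close> and write
  \<open>f b\<^sub>j = \<Sum>\<^sub>l N\<^sub>j\<^sub>l e\<^sub>l\<close> with \<open>N\<^sub>j\<^sub>l \<in> S[t]\<close>. By injectivity, no nonzero vector over the domain
  \<open>K[t]\<close> is a linear relation between the rows of \<open>N\<close> modulo \<open>\<mm>\<close>, so \<open>r \<le> s\<close>. If \<open>r = s\<close>, then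
  \<open>D = det N\<close> is nonzero modulo \<open>\<mm>\<close>, and the adjugate matrix gives \<open>D e\<^sub>l = g f\<close> with
  \<open>g \<in> S[t]\<close>. Since \<open>S\<close> is factorial, the prime factors of a nonzero \<open>e\<^sub>l\<close> can be cancelled one by
  one: each divides \<open>f\<close> or the other factor. If none of them divides \<open>f\<close>, then \<open>f\<close> divides \<open>D\<close>;
  but \<open>f\<close> vanishes modulo \<open>\<mm>\<close> while \<open>D\<close> does not. So some prime \<open>p\<close> of \<open>S\<close> divides all \<open>x\<^sub>i\<close>,
  that is \<open>I \<subseteq> (p)\<close>, and \<open>I\<close> has height at most 1. This is lemma \<open>num_gens_growth\<close>.

  The argument uses that \<open>S\<close> is Noetherian (\<open>hilbert_basis\<close>) and factorial
  (\<open>factorial_on_polys\<close>). Both are proved by induction on the number of variables. As the number of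
  variables is a term and not a type, the rings are subrings \<open>A\<close> of one fixed commutative ring
  type, and the induction step identifies the polynomials in \<open>n + 1\<close> variables with the univariate
  polynomials whose coefficients are polynomials in \<open>n\<close> variables.
\<close>

section \<open>Subrings of a ring type and their ideals\<close>

abbreviation ring_on :: "'a::comm_ring_1 set \<Rightarrow> 'a ring"
  where "ring_on A \<equiv> ring_of_type_algebra\<lparr>carrier := A\<rparr>"

lemma ring_on_simps [simp]:
  "carrier (ring_on A) = A"
  "monoid.mult (ring_on A) = (*)"
  "one (ring_on A) = 1"
  "ring.zero (ring_on A) = 0"
  "add (ring_on A) = (+)"
  by (auto simp: ring_of_type_algebra_def fun_eq_iff)

text \<open>
  The ideal generated by \<open>G\<close>, if \<open>A\<close> is a subring that contains \<open>G\<close>. The inductive form makes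
  statements about its elements provable by induction on the length of a linear combination.
\<close>
inductive_set gen :: "'a::comm_ring_1 set \<Rightarrow> 'a set \<Rightarrow> 'a set" for A G where
  zero: "0 \<in> gen A G"
| step: "a \<in> A \<Longrightarrow> x \<in> G \<Longrightarrow> y \<in> gen A G \<Longrightarrow> a * x + y \<in> gen A G"

lemma gen_add: "x \<in> gen A G \<Longrightarrow> y \<in> gen A G \<Longrightarrow> x + y \<in> gen A G"
  by (induction rule: gen.induct) (auto simp: add.assoc intro: gen.intros)

lemma gen_subset_mono: "G \<subseteq> Y \<Longrightarrow> gen A G \<subseteq> gen A Y"
proof
  fix x assume "G \<subseteq> Y" "x \<in> gen A G"
  from this(2,1) show "x \<in> gen A Y"
    by (induction rule: gen.induct) (auto intro: gen.intros)
qed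

lemma gen_finite_subset:
  "y \<in> gen A G \<Longrightarrow> \<exists>Y \<subseteq> G. finite Y \<and> y \<in> gen A Y"
proof (induction rule: gen.induct)
  case zero
  show ?case by (auto intro: gen.zero)
next
  case (step a x y)
  then obtain Y where Y: "Y \<subseteq> G" "finite Y" "y \<in> gen A Y" by blast
  then have "y \<in> gen A (insert x Y)"
    using gen_subset_mono[of Y "insert x Y" A] by blast
  then have "a * x + y \<in> gen A (insert x Y)"
    using step by (intro gen.step) auto
  then show ?case using Y step by (intro exI[of _ "insert x Y"]) auto
qed

lemma gen_finite_subset_set:
  assumes "finite F" "F \<subseteq> gen A G"
  shows "\<exists>Y \<subseteq> G. finite Y \<and> F \<subseteq> gen A Y"
  using assms
proof (induction F rule: finite_induct)
  case empty
  then show ?case by auto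
next
  case (insert y F)
  then obtain Y Z where "Y \<subseteq> G" "finite Y" "F \<subseteq> gen A Y" "Z \<subseteq> G" "finite Z" "y \<in> gen A Z"
    using gen_finite_subset[of y A G] by (metis insert_subset)
  then show ?case
    using gen_subset_mono[of Y "Y \<union> Z" A] gen_subset_mono[of Z "Y \<union> Z" A]
    by (intro exI[of _ "Y \<union> Z"]) auto
qed

lemma gen_image_lessThan:
  fixes r :: nat
  assumes "y \<in> gen A (b ` {..<r})" "0 \<in> A" "\<And>x y. x \<in> A \<Longrightarrow> y \<in> A \<Longrightarrow> x + y \<in> A"
  shows "\<exists>c. (\<forall>j<r. c j \<in> A) \<and> y = (\<Sum>j<r. c j * b j)"
  using assms(1)
proof (induction rule: gen.induct)
  case zero
  show ?case using assms(2) by (intro exI[of _ "\<lambda>_. 0"]) auto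
next
  case (step a x y)
  then obtain c j where c: "\<forall>j<r. c j \<in> A" "y = (\<Sum>j<r. c j * b j)" and j: "j < r" "x = b j"
    by auto
  have "(\<Sum>i<r. (c(j := a + c j)) i * b i) = (\<Sum>i<r. c i * b i + (if i = j then a * b j else 0))"
    by (intro sum.cong) (auto simp: algebra_simps)
  also have "\<dots> = a * x + y"
    using j c by (auto simp: sum.distrib)
  finally show ?case
    using c step assms j by (intro exI[of _ "c(j := a + c j)"]) auto
qed

locale type_subring =
  fixes A :: "'a::comm_ring_1 set"
  assumes one_mem: "1 \<in> A"
    and diff_mem: "x \<in> A \<Longrightarrow> y \<in> A \<Longrightarrow> x - y \<in> A"
    and mult_mem: "x \<in> A \<Longrightarrow> y \<in> A \<Longrightarrow> x * y \<in> A"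
begin

lemma zero_mem: "0 \<in> A"
  using diff_mem[OF one_mem one_mem] by simp

lemma uminus_mem: "x \<in> A \<Longrightarrow> - x \<in> A"
  using diff_mem[OF zero_mem, of x] by simp

lemma add_mem: "x \<in> A \<Longrightarrow> y \<in> A \<Longrightarrow> x + y \<in> A"
  using diff_mem[OF _ uminus_mem, of x y] by simp

lemma sum_mem: "(\<And>i. i \<in> I \<Longrightarrow> f i \<in> A) \<Longrightarrow> sum f I \<in> A"
  by (induction I rule: infinite_finite_induct) (auto simp: zero_mem add_mem)

lemma prod_mem: "(\<And>i. i \<in> I \<Longrightarrow> f i \<in> A) \<Longrightarrow> prod f I \<in> A"
  by (induction I rule: infinite_finite_induct) (auto simp: one_mem mult_mem)

lemma power_mem: "x \<in> A \<Longrightarrow> x ^ k \<in> A"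
  by (induction k) (auto simp: one_mem mult_mem)

lemma cring_on: "cring (ring_on A)"
proof (rule cringI)
  show "abelian_group (ring_on A)"
  proof (rule abelian_groupI)
    fix x assume "x \<in> carrier (ring_on A)"
    then show "\<exists>y\<in>carrier (ring_on A). y \<oplus>\<^bsub>ring_on A\<^esub> x = \<zero>\<^bsub>ring_on A\<^esub>"
      by (intro bexI[of _ "- x"]) (auto simp: uminus_mem)
  qed (auto simp: add_mem zero_mem algebra_simps)
  show "comm_monoid (ring_on A)"
    by (rule comm_monoidI) (auto simp: mult_mem one_mem algebra_simps)
qed (auto simp: algebra_simps)

lemma a_inv_on: "x \<in> A \<Longrightarrow> a_inv (ring_on A) x = - x"
proof -
  interpret cring "ring_on A" by (rule cring_on)
  show "x \<in> A \<Longrightarrow> a_inv (ring_on A) x = - x"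
    by (rule minus_equality) (auto simp: uminus_mem)
qed

lemma ideal_on_iff:
  "ideal J (ring_on A) \<longleftrightarrow> J \<subseteq> A \<and> 0 \<in> J \<and> (\<forall>x\<in>J. \<forall>y\<in>J. x + y \<in> J) \<and> (\<forall>a\<in>A. \<forall>x\<in>J. a * x \<in> J)"
    (is "_ \<longleftrightarrow> ?R")
proof
  assume J: "ideal J (ring_on A)"
  interpret J: ideal J "ring_on A" by (rule J)
  show ?R
    using J.a_subset additive_subgroup.zero_closed[OF ideal.axioms(1)[OF J]]
      additive_subgroup.a_closed[OF ideal.axioms(1)[OF J]] J.I_l_closed by auto
next
  assume R: ?R
  interpret R: cring "ring_on A" by (rule cring_on)
  have R': "\<forall>a\<in>A. \<forall>x\<in>J. x * a \<in> J" using R by (simp add: mult.commute)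
  show "ideal J (ring_on A)"
  proof (rule idealI)
    show "subgroup J (add_monoid (ring_on A))"
    proof (rule subgroup.intro)
      fix x assume x: "x \<in> J"
      have "inv\<^bsub>add_monoid (ring_on A)\<^esub> x = - x"
        using a_inv_on[of x] x R by (auto simp: a_inv_def)
      moreover have "- 1 * x \<in> J"
        using R x uminus_mem[OF one_mem] by blast
      ultimately show "inv\<^bsub>add_monoid (ring_on A)\<^esub> x \<in> J" by simp
    qed (use R in auto)
  next
    show "ring (ring_on A)" by (rule R.ring_axioms)
  qed (use R R' in auto)
qed

lemma ideal_onD:
  assumes "ideal J (ring_on A)"
  shows "x \<in> J \<Longrightarrow> x \<in> A" "0 \<in> J" "x \<in> J \<Longrightarrow> y \<in> J \<Longrightarrow> x + y \<in> J"
    "a \<in> A \<Longrightarrow> x \<in> J \<Longrightarrow> a * x \<in> J" "x \<in> J \<Longrightarrow> y \<in> J \<Longrightarrow> x - y \<in> J"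
    "(\<And>i. i \<in> F \<Longrightarrow> g i \<in> J) \<Longrightarrow> sum g F \<in> J"
proof -
  have *: "J \<subseteq> A \<and> 0 \<in> J \<and> (\<forall>x\<in>J. \<forall>y\<in>J. x + y \<in> J) \<and> (\<forall>a\<in>A. \<forall>x\<in>J. a * x \<in> J)"
    using assms by (simp add: ideal_on_iff)
  show "x \<in> J \<Longrightarrow> x \<in> A" "0 \<in> J" "x \<in> J \<Longrightarrow> y \<in> J \<Longrightarrow> x + y \<in> J"
    "a \<in> A \<Longrightarrow> x \<in> J \<Longrightarrow> a * x \<in> J"
    using * by blast+
  show "x - y \<in> J" if "x \<in> J" "y \<in> J"
  proof -
    have "x + (- 1) * y \<in> J"
      using * that uminus_mem[OF one_mem] by blast
    then show ?thesis by simp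
  qed
  show "(\<And>i. i \<in> F \<Longrightarrow> g i \<in> J) \<Longrightarrow> sum g F \<in> J"
    using * by (induction F rule: infinite_finite_induct) auto
qed

lemma gen_subset: 
  assumes "ideal J (ring_on A)" "G \<subseteq> J"
  shows "gen A G \<subseteq> J"
proof
  fix x assume "x \<in> gen A G"
  then show "x \<in> J"
    by (induction rule: gen.induct) (use assms ideal_onD[OF assms(1)] in auto)
qed

lemma gen_self: "G \<subseteq> gen A G"
  using gen.step[OF one_mem _ gen.zero, of _ G] by auto

lemma gen_mult:
  assumes a: "a \<in> A"
  shows "y \<in> gen A G \<Longrightarrow> a * y \<in> gen A G"
proof (induction rule: gen.induct)
  case (step b x y)
  then show ?case
    using gen.step[OF mult_mem[OF a step(1)] step(2) step.IH] by (simp add: algebra_simps)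
qed (auto intro: gen.zero)

lemma gen_subset_carrier: 
  assumes "G \<subseteq> A"
  shows "gen A G \<subseteq> A"
proof
  fix x assume "x \<in> gen A G"
  then show "x \<in> A"
    by (induction rule: gen.induct) (use assms in \<open>auto simp: zero_mem add_mem mult_mem\<close>)
qed

lemma ideal_gen: "G \<subseteq> A \<Longrightarrow> ideal (gen A G) (ring_on A)"
  using gen_subset_carrier[of G] by (auto simp: ideal_on_iff gen_add gen_mult intro: gen.zero)

lemma Idl_eq_gen: "G \<subseteq> A \<Longrightarrow> Idl\<^bsub>ring_on A\<^esub> G = gen A G"
  using ideal_gen[of G] gen_subset[of _ G] gen_self[of G] unfolding genideal_def
  by (intro equalityI) auto

lemma gen_image_lessThan_iff:
  fixes r :: nat
  shows "y \<in> gen A (b ` {..<r}) \<longleftrightarrow> (\<exists>c. (\<forall>j<r. c j \<in> A) \<and> y = (\<Sum>j<r. c j * b j))"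
proof
  assume "\<exists>c. (\<forall>j<r. c j \<in> A) \<and> y = (\<Sum>j<r. c j * b j)"
  then obtain c where c: "\<forall>j<r. c j \<in> A" "y = (\<Sum>j<r. c j * b j)" by blast
  have "(\<Sum>j<q. c j * b j) \<in> gen A (b ` {..<r})" if "q \<le> r" for q
    using that
  proof (induct q)
    case (Suc q)
    then show ?case
      using gen.step[of "c q" A "b q" "b ` {..<r}" "\<Sum>j<q. c j * b j"] c(1) by (simp add: add.commute)
  qed (auto intro: gen.zero)
  then show "y \<in> gen A (b ` {..<r})" using c(2) by simp
qed (auto intro: gen_image_lessThan zero_mem add_mem)

text \<open>
  Applied to the maximal ideal \<open>K\<close> and to generators \<open>b\<close> of \<open>I\<^sup>k\<close>, this describes the ideals by which
  the fiber ring divides.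
\<close>
lemma ideal_prod_gen_iff:
  fixes r :: nat
  assumes "ideal K (ring_on A)" "b ` {..<r} \<subseteq> A"
  shows "y \<in> K \<cdot>\<^bsub>ring_on A\<^esub> gen A (b ` {..<r}) \<longleftrightarrow> (\<exists>c. (\<forall>j<r. c j \<in> K) \<and> y = (\<Sum>j<r. c j * b j))"
proof
  note K = ideal_onD[OF assms(1)]
  assume "y \<in> K \<cdot>\<^bsub>ring_on A\<^esub> gen A (b ` {..<r})"
  then show "\<exists>c. (\<forall>j<r. c j \<in> K) \<and> y = (\<Sum>j<r. c j * b j)"
  proof (induction rule: ideal_prod.induct)
    case (prod i j)
    then obtain c where c: "\<forall>l<r. c l \<in> A" "j = (\<Sum>l<r. c l * b l)"
      by (auto simp: gen_image_lessThan_iff)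
    moreover have "i * c l \<in> K" if "l < r" for l
      using K(4)[of "c l" i] c prod that by (simp add: mult.commute)
    ultimately show ?case
      by (intro exI[of _ "\<lambda>l. i * c l"]) (auto simp: sum_distrib_left mult.assoc)
  next
    case (sum s1 s2)
    then obtain c d where "\<forall>j<r. c j \<in> K" "s1 = (\<Sum>j<r. c j * b j)"
      "\<forall>j<r. d j \<in> K" "s2 = (\<Sum>j<r. d j * b j)" by blast
    then show ?case
      using K(3) by (intro exI[of _ "\<lambda>l. c l + d l"]) (auto simp: sum.distrib algebra_simps)
  qed
next
  note K = ideal_onD[OF assms(1)]
  let ?J = "K \<cdot>\<^bsub>ring_on A\<^esub> gen A (b ` {..<r})"
  interpret R: cring "ring_on A" by (rule cring_on)
  have J: "ideal ?J (ring_on A)"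
    using R.ideal_prod_is_ideal assms(1) ideal_gen[OF assms(2)] by blast
  assume "\<exists>c. (\<forall>j<r. c j \<in> K) \<and> y = (\<Sum>j<r. c j * b j)"
  then obtain c where c: "\<forall>j<r. c j \<in> K" "y = (\<Sum>j<r. c j * b j)" by blast
  have "c j * b j \<in> ?J" if "j < r" for j
    using ideal_prod.prod[of "c j" K "b j" "gen A (b ` {..<r})" "ring_on A"] c that gen_self[of "b ` {..<r}"] by auto
  then show "y \<in> ?J" using ideal_onD(6)[OF J, of "{..<r}" "\<lambda>j. c j * b j"] c by auto
qed

lemma ideal_prod_gen:
  assumes "G \<subseteq> A" "Y \<subseteq> A"
  shows "gen A G \<cdot>\<^bsub>ring_on A\<^esub> gen A Y = gen A {x * y | x y. x \<in> G \<and> y \<in> Y}" (is "_ = gen A ?Z")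
proof
  interpret R: cring "ring_on A" by (rule cring_on)
  have Z: "?Z \<subseteq> A" using assms mult_mem by blast
  note ideals = ideal_gen[OF assms(1)] ideal_gen[OF assms(2)] ideal_gen[OF Z]
  note Zc = ideal_onD[OF ideals(3)]
  have prod: "i * j \<in> gen A ?Z" if "i \<in> gen A G" "j \<in> gen A Y" for i j
    using that(1)
  proof (induction rule: gen.induct)
    case (step a x y)
    from that(2) have "x * j \<in> gen A ?Z"
    proof (induction rule: gen.induct)
      case (step b x' y')
      have "b * (x * x') + x * y' \<in> gen A ?Z"
        using step \<open>x \<in> G\<close> by (intro gen.step) auto
      then show ?case by (simp add: algebra_simps)
    qed (auto intro: gen.zero)
    then have "a * (x * j) + y * j \<in> gen A ?Z"
      using Zc step by blast
    then show ?case by (simp add: algebra_simps)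
  qed (auto intro: gen.zero)
  show "gen A G \<cdot>\<^bsub>ring_on A\<^esub> gen A Y \<subseteq> gen A ?Z"
  proof
    fix s assume "s \<in> gen A G \<cdot>\<^bsub>ring_on A\<^esub> gen A Y"
    then show "s \<in> gen A ?Z"
      by (induction rule: ideal_prod.induct) (use prod Zc in auto)
  qed
  show "gen A ?Z \<subseteq> gen A G \<cdot>\<^bsub>ring_on A\<^esub> gen A Y"
  proof (rule gen_subset)
    show "ideal (gen A G \<cdot>\<^bsub>ring_on A\<^esub> gen A Y) (ring_on A)"
      using R.ideal_prod_is_ideal ideals by blast
    show "?Z \<subseteq> gen A G \<cdot>\<^bsub>ring_on A\<^esub> gen A Y"
      using ideal_prod.prod[of _ "gen A G" _ "gen A Y" "ring_on A"] gen_self[of G] gen_self[of Y] by auto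
  qed
qed

end

section \<open>Hilbert's basis theorem\<close>

definition polys :: "'a::comm_ring_1 set \<Rightarrow> 'a poly set"
  where "polys A = {p. \<forall>i. coeff p i \<in> A}"

lemma coeff_polys: "p \<in> polys A \<Longrightarrow> coeff p i \<in> A"
  by (simp add: polys_def)

definition noetherian_on :: "'a::comm_ring_1 set \<Rightarrow> bool"
  where "noetherian_on A \<longleftrightarrow>
    (\<forall>J. ideal J (ring_on A) \<longrightarrow> (\<exists>G \<subseteq> J. finite G \<and> J = gen A G))"

lemma noetherian_onD:
  "noetherian_on A \<Longrightarrow> ideal J (ring_on A) \<Longrightarrow> \<exists>G \<subseteq> J. finite G \<and> J = gen A G"
  by (simp add: noetherian_on_def)

context type_subring
begin

lemma type_subring_polys: "type_subring (polys A)"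
proof
  show "x * y \<in> polys A" if "x \<in> polys A" "y \<in> polys A" for x y
    using that by (auto simp: polys_def coeff_mult intro!: sum_mem mult_mem)
qed (auto simp: polys_def coeff_1 zero_mem one_mem diff_mem)

interpretation polys: type_subring "polys A"
  by (rule type_subring_polys)

lemma monom_mem: "a \<in> A \<Longrightarrow> monom a d \<in> polys A"
  by (auto simp: polys_def zero_mem)

lemma const_mem: "a \<in> A \<Longrightarrow> [:a:] \<in> polys A"
  using monom_mem[of a 0] by (simp add: monom_0)

lemma smult_mem: "a \<in> A \<Longrightarrow> p \<in> polys A \<Longrightarrow> smult a p \<in> polys A"
  by (auto simp: polys_def mult_mem)

lemma coeff_ideal:
  assumes "ideal J (ring_on (polys A))"
  shows "ideal {coeff f d |f. f \<in> J \<and> degree f \<le> d} (ring_on A)" (is "ideal ?L _")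
proof -
  note J = polys.ideal_onD[OF assms]
  have "x + y \<in> ?L" if xy: "x \<in> ?L" "y \<in> ?L" for x y
  proof -
    obtain f g where "f \<in> J" "degree f \<le> d" "x = coeff f d" "g \<in> J" "degree g \<le> d" "y = coeff g d"
      using xy by blast
    then show ?thesis
      using J(3) by (auto intro!: exI[of _ "f + g"] degree_add_le)
  qed
  moreover have "a * x \<in> ?L" if ax: "a \<in> A" "x \<in> ?L" for a x
  proof -
    obtain f where f: "f \<in> J" "degree f \<le> d" "x = coeff f d"
      using ax by blast
    have "smult a f \<in> J" using J(4)[OF const_mem[OF ax(1)] f(1)] by simp
    then show ?thesis
      using f degree_smult_le[of a f] by (auto intro!: exI[of _ "smult a f"])
  qed
  moreover have "0 \<in> ?L"
    using J(2) by (auto intro!: exI[of _ 0])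
  moreover have "?L \<subseteq> A"
    using J(1) coeff_polys by auto
  ultimately show ?thesis
    unfolding ideal_on_iff by blast
qed

text \<open>
  Let \<open>L d\<close> be the ideal of \<open>d\<close>-th coefficients of the elements of \<open>J\<close> of degree at most \<open>d\<close>. These
  ideals increase with \<open>d\<close>, and their union is finitely generated, so they are constant from some
  \<open>N\<close> on. Finitely many elements of \<open>J\<close> realise generators of \<open>L 0, \<dots>, L N\<close>, and by shifting
  them one can lower the degree of any element of \<open>J\<close>.
\<close>
theorem hilbert_basis:
  assumes "noetherian_on A"
  shows "noetherian_on (polys A)"
  unfolding noetherian_on_def
proof (intro allI impI)
  fix J assume idealJ: "ideal J (ring_on (polys A))"
  note J = polys.ideal_onD[OF idealJ]
  define L where "L d = {coeff f d |f. f \<in> J \<and> degree f \<le> d}" for d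
  have L: "ideal (L d) (ring_on A)" for d
    unfolding L_def using coeff_ideal[OF idealJ] .
  note Ld = ideal_onD[OF L]
  have "L d \<subseteq> L (Suc d)" for d
  proof
    fix x assume "x \<in> L d"
    then obtain f where f: "f \<in> J" "degree f \<le> d" "x = coeff f d"
      by (auto simp: L_def)
    have "monom 1 1 * f \<in> J" using J(4)[OF monom_mem[OF one_mem] f(1)] .
    moreover have "degree (monom 1 1 * f) \<le> Suc d"
      using degree_mult_le[of "monom 1 1" f] degree_monom_le[of "1::'a" 1] f(2) by linarith
    moreover have "coeff (monom 1 1 * f) (Suc d) = x"
      using f by (simp add: coeff_monom_mult)
    ultimately show "x \<in> L (Suc d)" unfolding L_def by blast
  qed
  then have L_mono: "d \<le> e \<Longrightarrow> L d \<subseteq> L e" for d e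
    by (rule lift_Suc_mono_le)
  have U_add: "x + y \<in> (\<Union>d. L d)" if "x \<in> L d" "y \<in> L e" for x y d e
    using Ld(3)[of x "max d e" y] L_mono[of d "max d e"] L_mono[of e "max d e"] that by auto
  have "ideal (\<Union>d. L d) (ring_on A)"
    unfolding ideal_on_iff
  proof (intro conjI ballI)
    show "(\<Union>d. L d) \<subseteq> A" using Ld(1) by blast
    show "0 \<in> (\<Union>d. L d)" using Ld(2) by blast
    show "x + y \<in> (\<Union>d. L d)" if "x \<in> (\<Union>d. L d)" "y \<in> (\<Union>d. L d)" for x y
      using that U_add by (elim UN_E)
    show "a * x \<in> (\<Union>d. L d)" if "a \<in> A" "x \<in> (\<Union>d. L d)" for a x
      using that Ld(4) by blast
  qed
  then obtain G where G: "G \<subseteq> (\<Union>d. L d)" "finite G" "(\<Union>d. L d) = gen A G"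
    using noetherian_onD[OF assms] by metis
  have "\<exists>N. G \<subseteq> L N"
    using G(2,1)
  proof (induction G rule: finite_induct)
    case (insert x G)
    then obtain N d where "G \<subseteq> L N" "x \<in> L d" by auto
    then show ?case
      using L_mono[of d "max d N"] L_mono[of N "max d N"] by (intro exI[of _ "max d N"]) auto
  qed auto
  then obtain N where "G \<subseteq> L N" by blast
  then have L_le: "L d \<subseteq> L N" for d
    using gen_subset[OF L, of G N] G(3) by auto
  have "\<exists>H. H \<subseteq> {f \<in> J. degree f \<le> d} \<and> finite H \<and> L d = gen A ((\<lambda>f. coeff f d) ` H)" for d
  proof -
    obtain G' where G': "G' \<subseteq> L d" "finite G'" "L d = gen A G'"
      using noetherian_onD[OF assms L] by metis
    moreover have "L d = (\<lambda>f. coeff f d) ` {f \<in> J. degree f \<le> d}"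
      by (auto simp: L_def)
    ultimately obtain H where "H \<subseteq> {f \<in> J. degree f \<le> d}" "finite H" "G' = (\<lambda>f. coeff f d) ` H"
      using finite_subset_image[of G' "\<lambda>f. coeff f d" "{f \<in> J. degree f \<le> d}"] by auto
    then show ?thesis
      using G'(3) by (intro exI[of _ H]) simp
  qed
  then obtain H where H: "\<And>d. H d \<subseteq> {f \<in> J. degree f \<le> d}" "\<And>d. finite (H d)"
    "\<And>d. L d = gen A ((\<lambda>f. coeff f d) ` H d)"
    by metis
  define B where "B = (\<Union>d\<le>N. H d)"
  have BJ: "B \<subseteq> J" using H(1) by (auto simp: B_def)
  have genB: "gen (polys A) B \<subseteq> J"
    by (rule polys.gen_subset[OF idealJ BJ])
  have lift: "\<exists>g \<in> gen (polys A) B. degree g \<le> k \<and> coeff g k = y"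
    if "y \<in> gen A ((\<lambda>f. coeff f e) ` H e)" "e \<le> N" "e \<le> k" for y e k
    using that(1)
  proof (induction rule: gen.induct)
    case zero
    show ?case by (intro bexI[of _ 0]) (auto intro: gen.zero)
  next
    case (step a x y)
    then obtain g h where g: "g \<in> gen (polys A) B" "degree g \<le> k" "coeff g k = y"
      and h: "h \<in> H e" "x = coeff h e" by blast
    have hB: "h \<in> B" "degree h \<le> e" using h H(1)[of e] that by (auto simp: B_def)
    have "degree (monom a (k - e) * h) \<le> k"
      using degree_mult_le[of "monom a (k - e)" h] degree_monom_le[of a "k - e"] hB(2) that(3)
      by linarith
    moreover have "coeff (monom a (k - e) * h) k = a * x"
      using h that by (simp add: coeff_monom_mult)
    moreover have "monom a (k - e) * h + g \<in> gen (polys A) B"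
      using gen.step[OF monom_mem[OF step(1)] hB(1) g(1)] .
    ultimately show ?case
      using g by (intro bexI[of _ "monom a (k - e) * h + g"]) (auto intro: degree_add_le)
  qed
  have "f \<in> gen (polys A) B" if "f \<in> J" "degree f < k" for f k
    using that
  proof (induction k arbitrary: f)
    case (Suc k)
    show ?case
    proof (cases "degree f < k")
      case False
      then have deg: "degree f = k" using Suc by auto
      have "coeff f k \<in> L k" unfolding L_def using Suc deg by auto
      then have "coeff f k \<in> L (min k N)" using L_le[of k] by (cases "k \<le> N") (auto simp: min_def)
      then obtain g where g: "g \<in> gen (polys A) B" "degree g \<le> k" "coeff g k = coeff f k"
        using lift[of "coeff f k" "min k N" k] H(3)[of "min k N"] by auto
      have "f - g \<in> gen (polys A) B"
      proof (cases "f - g = 0")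
        case True
        then show ?thesis by (simp only: True gen.zero)
      next
        case nz: False
        have "degree (f - g) \<le> k" using deg g(2) by (intro degree_diff_le) auto
        moreover have "degree (f - g) \<noteq> k"
          using g(3) nz leading_coeff_0_iff[of "f - g"] by auto
        ultimately show ?thesis
          using Suc.IH[of "f - g"] J(5)[of f g] g(1) genB Suc.prems by auto
      qed
      then show ?thesis using gen_add[OF _ g(1), of "f - g"] by simp
    qed (use Suc in auto)
  qed auto
  then have "J \<subseteq> gen (polys A) B" by blast
  then have "J = gen (polys A) B" using genB by blast
  then show "\<exists>G \<subseteq> J. finite G \<and> J = gen (polys A) G"
    using BJ H(2) by (intro exI[of _ B]) (auto simp: B_def)
qed

end

section \<open>Factorial domains and Gauss's lemma\<close>

definition unit_on :: "'a::comm_ring_1 set \<Rightarrow> 'a \<Rightarrow> bool"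
  where "unit_on A u \<longleftrightarrow> u \<in> A \<and> (\<exists>v\<in>A. u * v = 1)"

definition dvd_on :: "'a::comm_ring_1 set \<Rightarrow> 'a \<Rightarrow> 'a \<Rightarrow> bool"
  where "dvd_on A a b \<longleftrightarrow> (\<exists>c\<in>A. b = a * c)"

definition prime_on :: "'a::comm_ring_1 set \<Rightarrow> 'a \<Rightarrow> bool"
  where "prime_on A p \<longleftrightarrow> p \<in> A \<and> p \<noteq> 0 \<and> \<not> unit_on A p \<and>
    (\<forall>x\<in>A. \<forall>y\<in>A. dvd_on A p (x * y) \<longrightarrow> dvd_on A p x \<or> dvd_on A p y)"

inductive_set prime_prods :: "'a::comm_ring_1 set \<Rightarrow> 'a set" for A where
  unit: "unit_on A u \<Longrightarrow> u \<in> prime_prods A"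
| mult: "prime_on A p \<Longrightarrow> x \<in> prime_prods A \<Longrightarrow> p * x \<in> prime_prods A"

text \<open>
  A factorisation into primes is unique up to units, so its existence characterises factorial
  domains.
\<close>
definition factorial_on :: "'a::comm_ring_1 set \<Rightarrow> bool"
  where "factorial_on A \<longleftrightarrow> (\<forall>a\<in>A. a \<noteq> 0 \<longrightarrow> a \<in> prime_prods A)"

definition primitive_on :: "'a::comm_ring_1 set \<Rightarrow> 'a poly \<Rightarrow> bool"
  where "primitive_on A p \<longleftrightarrow> (\<forall>\<pi>. prime_on A \<pi> \<longrightarrow> \<not> (\<forall>i. dvd_on A \<pi> (coeff p i)))"

lemma prime_onD:
  assumes "prime_on A p"
  shows "p \<in> A" "p \<noteq> 0" "\<not> unit_on A p"
    "x \<in> A \<Longrightarrow> y \<in> A \<Longrightarrow> dvd_on A p (x * y) \<Longrightarrow> dvd_on A p x \<or> dvd_on A p y"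
  using assms by (auto simp: prime_on_def)

locale type_subdomain = type_subring A for A :: "'a::idom set"
begin

lemma dvd_refl: "dvd_on A a a"
  using one_mem by (auto simp: dvd_on_def)

lemma dvd_trans: "dvd_on A a b \<Longrightarrow> dvd_on A b c \<Longrightarrow> dvd_on A a c"
  unfolding dvd_on_def by (metis mult.assoc mult_mem)

lemma dvd_mult_right: "c \<in> A \<Longrightarrow> dvd_on A a b \<Longrightarrow> dvd_on A a (b * c)"
  unfolding dvd_on_def by (metis mult.assoc mult_mem)

lemma dvd_mult_left: "c \<in> A \<Longrightarrow> dvd_on A a b \<Longrightarrow> dvd_on A a (c * b)"
  using dvd_mult_right[of c a b] by (simp add: mult.commute)

lemma dvd_diff: "dvd_on A a b \<Longrightarrow> dvd_on A a c \<Longrightarrow> dvd_on A a (b - c)"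
  unfolding dvd_on_def by (metis right_diff_distrib diff_mem)

lemma dvd_zero: "dvd_on A a 0"
  unfolding dvd_on_def using zero_mem by (intro bexI[of _ 0]) auto

lemma dvd_add: "dvd_on A a b \<Longrightarrow> dvd_on A a c \<Longrightarrow> dvd_on A a (b + c)"
  unfolding dvd_on_def by (metis distrib_left add_mem)

lemma dvd_sum: "(\<And>i. i \<in> I \<Longrightarrow> dvd_on A a (f i)) \<Longrightarrow> dvd_on A a (sum f I)"
  by (induction I rule: infinite_finite_induct) (auto simp: dvd_zero dvd_add)

lemma unit_mult: "unit_on A u \<Longrightarrow> unit_on A v \<Longrightarrow> unit_on A (u * v)"
proof -
  assume "unit_on A u" "unit_on A v"
  then obtain u' v' where "u \<in> A" "v \<in> A" "u' \<in> A" "v' \<in> A" "u * u' = 1" "v * v' = 1"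
    by (auto simp: unit_on_def)
  moreover have "(u * v) * (u' * v') = (u * u') * (v * v')" by (simp add: ac_simps)
  ultimately show ?thesis
    unfolding unit_on_def using mult_mem by (metis mult_1)
qed

lemma unit_one: "unit_on A 1"
  using one_mem by (auto simp: unit_on_def)

lemma unit_factor: "a \<in> A \<Longrightarrow> b \<in> A \<Longrightarrow> unit_on A (a * b) \<Longrightarrow> unit_on A a"
  unfolding unit_on_def by (metis mult.assoc mult_mem)

lemma dvd_unit: "dvd_on A a u \<Longrightarrow> a \<in> A \<Longrightarrow> unit_on A u \<Longrightarrow> unit_on A a"
  using unit_factor by (auto simp: dvd_on_def)

lemma prime_prods_carrier: "x \<in> prime_prods A \<Longrightarrow> x \<in> A"
  by (induction rule: prime_prods.induct) (auto simp: unit_on_def prime_on_def mult_mem)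

lemma prime_prods_mult:
  "x \<in> prime_prods A \<Longrightarrow> y \<in> prime_prods A \<Longrightarrow> x * y \<in> prime_prods A"
proof (induction rule: prime_prods.induct)
  case (unit u)
  from unit(2,1) show ?case
  proof (induction rule: prime_prods.induct)
    case (mult p x)
    then show ?case using prime_prods.mult[of A p "u * x"] by (simp add: mult.left_commute)
  qed (auto intro: prime_prods.unit unit_mult)
next
  case (mult p x)
  then show ?case using prime_prods.mult[of A p "x * y"] by (simp add: mult.assoc)
qed

lemma prime_dvd_prime:
  assumes "prime_on A p" "prime_on A q" "dvd_on A p q"
  shows "dvd_on A q p"
proof -
  note p = prime_onD[OF assms(1)] and q = prime_onD[OF assms(2)]
  obtain w where w: "w \<in> A" "q = p * w" using assms(3) by (auto simp: dvd_on_def)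
  then consider "dvd_on A q p" | "dvd_on A q w"
    using q(4)[of p w] p(1) dvd_refl by metis
  then show ?thesis
  proof cases
    case 2
    then obtain v where v: "v \<in> A" "w = q * v" by (auto simp: dvd_on_def)
    have "q * 1 = p * (q * v)"
      by (simp only: v(2)[symmetric] w(2)[symmetric] mult_1_right)
    also have "\<dots> = q * (p * v)" by (rule mult.left_commute)
    finally have "q * 1 = q * (p * v)" .
    then have "p * v = 1" using q(2) by simp
    then show ?thesis using p v by (auto simp: unit_on_def)
  qed
qed

interpretation polys: type_subring "polys A"
  by (rule type_subring_polys)

lemma dvd_coeffs_imp:
  assumes "\<pi> \<noteq> 0" "\<And>i. dvd_on A \<pi> (coeff p i)"
  shows "\<exists>q \<in> polys A. p = smult \<pi> q"
proof -
  obtain c where c: "\<And>i. c i \<in> A" "\<And>i. coeff p i = \<pi> * c i"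
    using assms(2) unfolding dvd_on_def by metis
  define q where "q = (\<Sum>i\<le>degree p. monom (c i) i)"
  have "p = smult \<pi> q"
  proof (rule poly_eqI)
    fix i
    show "coeff p i = coeff (smult \<pi> q) i"
      using c(2)[of i] coeff_eq_0[of p i] by (auto simp: q_def coeff_sum not_le)
  qed
  moreover have "q \<in> polys A"
    unfolding q_def by (intro polys.sum_mem monom_mem c)
  ultimately show ?thesis by blast
qed

text \<open>
  Gauss's lemma: if \<open>\<pi>\<close> divides neither factor, look at the first coefficients \<open>p\<^sub>i\<close> and \<open>q\<^sub>j\<close> that it
  does not divide. In the coefficient of degree \<open>i + j\<close> of the product, all terms other than
  \<open>p\<^sub>i q\<^sub>j\<close> are divisible by \<open>\<pi>\<close>.
\<close>
lemma prime_dvd_coeffs: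
  assumes \<pi>: "prime_on A \<pi>" and pq: "p \<in> polys A" "q \<in> polys A"
    and dvd: "\<And>i. dvd_on A \<pi> (coeff (p * q) i)"
  shows "(\<forall>i. dvd_on A \<pi> (coeff p i)) \<or> (\<forall>i. dvd_on A \<pi> (coeff q i))"
proof (rule ccontr)
  assume "\<not> ?thesis"
  then have ex: "\<exists>i. \<not> dvd_on A \<pi> (coeff p i)" "\<exists>j. \<not> dvd_on A \<pi> (coeff q j)" by auto
  define i where "i = (LEAST i. \<not> dvd_on A \<pi> (coeff p i))"
  define j where "j = (LEAST j. \<not> dvd_on A \<pi> (coeff q j))"
  have i: "\<not> dvd_on A \<pi> (coeff p i)" "\<And>k. k < i \<Longrightarrow> dvd_on A \<pi> (coeff p k)"
    unfolding i_def using LeastI_ex[OF ex(1)] not_less_Least by blast+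
  have j: "\<not> dvd_on A \<pi> (coeff q j)" "\<And>k. k < j \<Longrightarrow> dvd_on A \<pi> (coeff q k)"
    unfolding j_def using LeastI_ex[OF ex(2)] not_less_Least by blast+
  have c: "coeff p k \<in> A" "coeff q k \<in> A" for k using pq by (auto intro: coeff_polys)
  have "dvd_on A \<pi> (\<Sum>k\<in>{..i + j} - {i}. coeff p k * coeff q (i + j - k))"
  proof (rule dvd_sum)
    fix k assume k: "k \<in> {..i + j} - {i}"
    show "dvd_on A \<pi> (coeff p k * coeff q (i + j - k))"
    proof (cases "k < i")
      case True
      then show ?thesis using i(2) c dvd_mult_right by blast
    next
      case False
      then have "i + j - k < j" using k by auto
      then show ?thesis using j(2) c dvd_mult_left by blast
    qed
  qed
  moreover have "coeff (p * q) (i + j) = coeff p i * coeff q j +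
      (\<Sum>k\<in>{..i + j} - {i}. coeff p k * coeff q (i + j - k))"
    by (simp add: coeff_mult sum.remove[of "{..i + j}" i])
  ultimately have "dvd_on A \<pi> (coeff p i * coeff q j)"
    using dvd_diff[OF dvd[of "i + j"], of "\<Sum>k\<in>{..i + j} - {i}. coeff p k * coeff q (i + j - k)"] by simp
  then show False using i(1) j(1) prime_onD(4)[OF \<pi> c(1) c(2)] by blast
qed

text \<open>
  Each prime factor of \<open>c\<close> divides \<open>q d\<close>, hence \<open>q\<close> because \<open>d\<close> is primitive, and can be cancelled.
\<close>
lemma gauss_cancel:
  assumes "c \<in> prime_prods A" "p \<in> polys A" "q \<in> polys A" "d \<in> polys A"
    and "smult c p = q * d" "primitive_on A d"
  shows "\<exists>q' \<in> polys A. p = q' * d"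
  using assms(1,3,5)
proof (induction arbitrary: q rule: prime_prods.induct)
  case (unit u)
  then obtain v where v: "v \<in> A" "u * v = 1" by (auto simp: unit_on_def)
  have "p = smult (v * u) p" using v by (simp add: mult.commute)
  also have "\<dots> = smult v q * d" using unit by (simp flip: smult_smult)
  finally show ?case using smult_mem[OF v(1) unit(2)] by blast
next
  case (mult \<pi> x)
  have \<pi>: "\<pi> \<noteq> 0" using mult prime_onD by blast
  have "coeff (q * d) i = \<pi> * (x * coeff p i)" for i
    using arg_cong[OF mult.prems(2), of "\<lambda>f. coeff f i"] by (simp add: mult.assoc)
  then have "dvd_on A \<pi> (coeff (q * d) i)" for i
    unfolding dvd_on_def using mult_mem[OF prime_prods_carrier[OF mult(2)] coeff_polys[OF assms(2)]]
    by blast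
  then have "\<forall>i. dvd_on A \<pi> (coeff q i)"
    using prime_dvd_coeffs[OF mult(1) mult.prems(1) assms(4)] assms(6) mult(1)
    unfolding primitive_on_def by blast
  then obtain q1 where q1: "q1 \<in> polys A" "q = smult \<pi> q1"
    using dvd_coeffs_imp[of \<pi> q] \<pi> by blast
  have "smult \<pi> (smult x p) = smult \<pi> (q1 * d)"
    using mult.prems q1 by simp
  then have "smult x p = q1 * d"
    using \<pi> by (simp add: smult_cancel)
  then show ?case using mult.IH[OF q1(1)] by blast
qed

text \<open>
  The prime factors of the leading coefficient are tried in turn, and those that divide all of \<open>p\<close>
  are split off. In the generalised claim \<open>y\<close> collects the factors that were rejected; the
  invariant is that no common prime divisor of the coefficients divides \<open>y\<close>.
\<close>
lemma content_exists:
  assumes "p \<in> polys A" "lead_coeff p \<in> prime_prods A"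
  shows "\<exists>c \<in> prime_prods A. \<exists>p' \<in> polys A. p = smult c p' \<and> primitive_on A p'"
proof -
  have "\<exists>c \<in> prime_prods A. \<exists>p' \<in> polys A. p = smult c p' \<and> primitive_on A p'"
    if "x \<in> prime_prods A" "p \<in> polys A" "y \<in> A" "lead_coeff p = y * x"
      "\<And>\<pi>. prime_on A \<pi> \<Longrightarrow> \<forall>i. dvd_on A \<pi> (coeff p i) \<Longrightarrow> \<not> dvd_on A \<pi> y" for x y p
    using that
  proof (induction arbitrary: y p rule: prime_prods.induct)
    case (unit u)
    obtain v where v: "v \<in> A" "u * v = 1" using unit(1) by (auto simp: unit_on_def)
    have "primitive_on A p"
      unfolding primitive_on_def
    proof (intro allI impI notI)
      fix \<pi> assume \<pi>: "prime_on A \<pi>" "\<forall>i. dvd_on A \<pi> (coeff p i)"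
      then have "dvd_on A \<pi> (y * u)" using unit(4) by metis
      then have "dvd_on A \<pi> (y * u * v)" using v dvd_mult_right by blast
      then show False using unit(5)[OF \<pi>] v by (simp add: mult.assoc)
    qed
    then show ?case
      using unit(2) by (intro bexI[of _ 1] bexI[of _ p]) (auto intro: prime_prods.unit unit_one)
  next
    case (mult \<rho> x)
    note \<rho> = prime_onD[OF mult(1)]
    show ?case
    proof (cases "\<forall>i. dvd_on A \<rho> (coeff p i)")
      case True
      then obtain p1 where p1: "p1 \<in> polys A" "p = smult \<rho> p1"
        using dvd_coeffs_imp[OF \<rho>(2)] by blast
      have "\<rho> * lead_coeff p1 = \<rho> * (y * x)"
        using mult.prems(3) p1 \<rho>(2) by (simp add: ac_simps)
      then have lc: "lead_coeff p1 = y * x" using \<rho>(2) by simp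
      have "\<not> dvd_on A \<pi> y" if "prime_on A \<pi>" "\<forall>i. dvd_on A \<pi> (coeff p1 i)" for \<pi>
        using mult.prems(4)[OF that(1)] that(2) p1 dvd_mult_left[OF \<rho>(1)] by simp
      then obtain c p' where "c \<in> prime_prods A" "p' \<in> polys A" "p1 = smult c p'" "primitive_on A p'"
        using mult.IH[OF p1(1) mult.prems(2) lc] by blast
      then show ?thesis
        using p1 prime_prods.mult[OF mult(1)] by (intro bexI[of _ "\<rho> * c"] bexI[of _ p']) auto
    next
      case False
      have "\<not> dvd_on A \<pi> (y * \<rho>)" if \<pi>: "prime_on A \<pi>" "\<forall>i. dvd_on A \<pi> (coeff p i)" for \<pi>
      proof
        assume "dvd_on A \<pi> (y * \<rho>)"
        then have "dvd_on A \<pi> \<rho>"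
          using prime_onD(4)[OF \<pi>(1) mult.prems(2) \<rho>(1)] mult.prems(4)[OF \<pi>] by blast
        then have "dvd_on A \<rho> \<pi>" using prime_dvd_prime[OF \<pi>(1) mult(1)] by blast
        then show False using False \<pi>(2) dvd_trans by blast
      qed
      then show ?thesis
        using mult.IH[OF mult.prems(1) mult_mem[OF mult.prems(2) \<rho>(1)]] mult.prems(3)
        by (simp add: mult.assoc)
    qed
  qed
  from this[OF assms(2,1) one_mem] show ?thesis
    using prime_onD dvd_unit[OF _ _ unit_one] by (metis mult_1)
qed

lemma pseudo_division:
  assumes "d \<in> polys A" "d \<noteq> 0" "z \<in> polys A"
  shows "\<exists>c q r. c \<in> A \<and> c \<noteq> 0 \<and> q \<in> polys A \<and> r \<in> polys A \<and> smult c z = q * d + r \<and>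
    (r = 0 \<or> degree r < degree d)"
  using assms(3)
proof (induction "degree z" arbitrary: z rule: less_induct)
  case (less z)
  show ?case
  proof (cases "z = 0 \<or> degree z < degree d")
    case True
    then show ?thesis
      using less(2) by (intro exI[of _ 1] exI[of _ 0] exI[of _ z])
        (auto simp: one_mem polys.zero_mem)
  next
    case False
    then have z: "z \<noteq> 0" "degree d \<le> degree z" by auto
    define l where "l = lead_coeff d"
    have l: "l \<in> A" "l \<noteq> 0" using assms by (auto simp: l_def coeff_polys)
    define m where "m = monom (lead_coeff z) (degree z - degree d)"
    have m: "m \<in> polys A" unfolding m_def by (intro monom_mem coeff_polys less)
    define z1 where "z1 = smult l z - m * d"
    have z1: "z1 \<in> polys A"
      unfolding z1_def using l m assms less by (intro polys.diff_mem polys.mult_mem smult_mem)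
    have "degree (m * d) \<le> degree z"
      using degree_mult_le[of m d] degree_monom_le[of "lead_coeff z" "degree z - degree d"] z
      unfolding m_def by linarith
    then have "degree z1 \<le> degree z"
      unfolding z1_def by (intro degree_diff_le) auto
    moreover have "coeff z1 (degree z) = 0"
      using z by (simp add: z1_def m_def l_def coeff_monom_mult)
    ultimately have "z1 = 0 \<or> degree z1 < degree z"
      using leading_coeff_0_iff[of z1] by (cases "degree z1 = degree z") auto
    then show ?thesis
    proof
      assume "z1 = 0"
      then show ?thesis
        using l m by (intro exI[of _ l] exI[of _ m] exI[of _ 0]) (auto simp: z1_def polys.zero_mem)
    next
      assume "degree z1 < degree z"
      then obtain c q r where IH: "c \<in> A" "c \<noteq> 0" "q \<in> polys A" "r \<in> polys A" "smult c z1 = q * d + r"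
        "r = 0 \<or> degree r < degree d"
        using less(1)[OF _ z1] by blast
      have "smult (c * l) z = smult c z1 + smult c m * d"
        by (simp add: z1_def smult_diff_right)
      also have "\<dots> = (q + smult c m) * d + r"
        by (simp add: IH algebra_simps)
      finally have "smult (c * l) z = (q + smult c m) * d + r" .
      moreover have "q + smult c m \<in> polys A" "c * l \<in> A" "c * l \<noteq> 0"
        using IH l m by (auto intro: polys.add_mem smult_mem mult_mem)
      ultimately show ?thesis using IH(4,6) by blast
    qed
  qed
qed

text \<open>
  The proof avoids the field of fractions. If \<open>p\<close> divides \<open>a b\<close>, take an element \<open>d = u p + v a\<close>
  of least degree in the ideal generated by \<open>p\<close> and \<open>a\<close>. Pseudo-division shows that \<open>d\<close> divides
  constant multiples of both \<open>p\<close> and \<open>a\<close>, so by Gauss's lemma its primitive part \<open>d'\<close> divides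
  \<open>p\<close> and \<open>a\<close> themselves. As \<open>p\<close> is irreducible, either \<open>d'\<close> is associated to \<open>p\<close>, which then
  divides \<open>a\<close>, or \<open>d'\<close> is a unit. In the latter case \<open>d\<close> is a constant up to a unit, and since \<open>p\<close>
  divides \<open>d b\<close>, it divides \<open>b\<close> by Gauss's lemma again.
\<close>
lemma irreducible_imp_prime_polys:
  assumes fact: "factorial_on A"
    and p: "p \<in> polys A" "p \<noteq> 0" "\<not> unit_on (polys A) p" "primitive_on A p"
    and irr: "\<And>q r. q \<in> polys A \<Longrightarrow> r \<in> polys A \<Longrightarrow> p = q * r \<Longrightarrow> unit_on (polys A) q \<or> unit_on (polys A) r"
  shows "prime_on (polys A) p"
  unfolding prime_on_def
proof (intro conjI ballI impI)
  have prods: "c \<in> prime_prods A" if "c \<in> A" "c \<noteq> 0" for c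
    using fact that by (auto simp: factorial_on_def)
  fix a b assume a: "a \<in> polys A" and b: "b \<in> polys A" and "dvd_on (polys A) p (a * b)"
  then obtain w where w: "w \<in> polys A" "a * b = p * w" by (auto simp: dvd_on_def)
  define J where "J = {u * p + v * a | u v. u \<in> polys A \<and> v \<in> polys A}"
  have "1 * p + 0 * a \<in> J"
    unfolding J_def using polys.one_mem polys.zero_mem by blast
  then have pJ: "p \<in> J" by simp
  define d where "d = arg_min degree (\<lambda>z. z \<in> J \<and> z \<noteq> 0)"
  have d: "d \<in> J" "d \<noteq> 0" "\<And>z. z \<in> J \<Longrightarrow> z \<noteq> 0 \<Longrightarrow> degree d \<le> degree z"
    using arg_min_nat_lemma[of "\<lambda>z. z \<in> J \<and> z \<noteq> 0" p degree] pJ p(2) unfolding d_def by blast+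
  obtain u v where uv: "u \<in> polys A" "v \<in> polys A" "d = u * p + v * a"
    using d(1) by (auto simp: J_def)
  have dA: "d \<in> polys A" using uv a p by (auto intro: polys.add_mem polys.mult_mem)
  have div: "\<exists>c q. c \<in> prime_prods A \<and> q \<in> polys A \<and> smult c z = q * d"
    if "z = s * p + t * a" "s \<in> polys A" "t \<in> polys A" for s t z
  proof -
    have "z \<in> polys A" using that a p by (auto intro: polys.add_mem polys.mult_mem)
    then obtain c q r where c: "c \<in> A" "c \<noteq> 0" "q \<in> polys A" "r \<in> polys A" "smult c z = q * d + r"
      "r = 0 \<or> degree r < degree d"
      using pseudo_division[OF dA d(2)] by blast
    have "r = smult c z - q * d" using c(5) by simp
    also have "\<dots> = (smult c s - q * u) * p + (smult c t - q * v) * a"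
      unfolding that(1) uv(3) by (simp add: algebra_simps smult_add_right)
    finally have "r = (smult c s - q * u) * p + (smult c t - q * v) * a" .
    moreover have "smult c s - q * u \<in> polys A" "smult c t - q * v \<in> polys A"
      using c that uv by (auto intro!: polys.diff_mem polys.mult_mem smult_mem)
    ultimately have "r \<in> J" unfolding J_def by blast
    then have "r = 0" using d(3)[of r] c(6) by linarith
    then show ?thesis using c prods by auto
  qed
  obtain c1 q1 where 1: "c1 \<in> prime_prods A" "q1 \<in> polys A" "smult c1 p = q1 * d"
    using div[of p 1 0] by (auto simp: polys.one_mem polys.zero_mem)
  obtain c2 q2 where 2: "c2 \<in> prime_prods A" "q2 \<in> polys A" "smult c2 a = q2 * d"
    using div[of a 0 1] by (auto simp: polys.one_mem polys.zero_mem)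
  obtain e d' where e: "e \<in> prime_prods A" "d' \<in> polys A" "d = smult e d'" "primitive_on A d'"
    using content_exists[OF dA] prods[of "lead_coeff d"] d(2) coeff_polys[OF dA] by auto
  have eA: "e \<in> A" using e prime_prods_carrier by blast
  have "smult c1 p = smult e q1 * d'" using 1 e by simp
  then obtain q where q: "q \<in> polys A" "p = q * d'"
    using gauss_cancel[OF 1(1) p(1) smult_mem[OF eA 1(2)] e(2) _ e(4)] by blast
  have "smult c2 a = smult e q2 * d'" using 2 e by simp
  then obtain r where r: "r \<in> polys A" "a = r * d'"
    using gauss_cancel[OF 2(1) a smult_mem[OF eA 2(2)] e(2) _ e(4)] by blast
  from irr[OF q(1) e(2) q(2)] show "dvd_on (polys A) p a \<or> dvd_on (polys A) p b"
  proof
    assume "unit_on (polys A) q"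
    then obtain q' where q': "q' \<in> polys A" "q * q' = 1" by (auto simp: unit_on_def)
    have "a = (q * q') * (r * d')" using q' r by simp
    also have "\<dots> = p * (r * q')" by (simp add: q(2) ac_simps)
    finally show ?thesis using polys.mult_mem[OF r(1) q'(1)] by (auto simp: dvd_on_def)
  next
    assume "unit_on (polys A) d'"
    then obtain x where x: "x \<in> polys A" "d' * x = 1" by (auto simp: unit_on_def)
    have "smult e b = smult e ((d' * x) * b)" using x by simp
    also have "\<dots> = (d * x) * b" by (simp add: e(3))
    also have "\<dots> = (u * x * b) * p + v * x * (a * b)" by (simp add: uv(3) algebra_simps)
    also have "\<dots> = (u * x * b + v * x * w) * p" by (simp add: w(2) algebra_simps)
    finally have "smult e b = (u * x * b + v * x * w) * p" .
    moreover have "u * x * b + v * x * w \<in> polys A"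
      using uv x b w by (intro polys.add_mem polys.mult_mem)
    ultimately obtain y where "y \<in> polys A" "b = y * p"
      using gauss_cancel[OF e(1) b _ p(1) _ p(4)] by blast
    then show ?thesis by (auto simp: dvd_on_def mult.commute)
  qed
qed (use p in auto)

lemma unit_polys_const: "unit_on A k \<Longrightarrow> unit_on (polys A) [:k:]"
proof -
  assume "unit_on A k"
  then obtain v where "k \<in> A" "v \<in> A" "k * v = 1" by (auto simp: unit_on_def)
  then show ?thesis
    unfolding unit_on_def using const_mem by (intro conjI bexI[of _ "[:v:]"]) (auto simp: one_pCons mult.commute)
qed

lemma prime_const_polys:
  assumes "prime_on A \<pi>"
  shows "prime_on (polys A) [:\<pi>:]"
  unfolding prime_on_def
proof (intro conjI ballI impI)
  note \<pi> = prime_onD[OF assms]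
  show "[:\<pi>:] \<in> polys A" "[:\<pi>:] \<noteq> 0" using \<pi> const_mem by auto
  show "\<not> unit_on (polys A) [:\<pi>:]"
  proof
    assume "unit_on (polys A) [:\<pi>:]"
    then obtain q where q: "q \<in> polys A" "[:\<pi>:] * q = 1" by (auto simp: unit_on_def)
    have "\<pi> * coeff q 0 = 1" using arg_cong[OF q(2), of "\<lambda>f. coeff f 0"] by simp
    then show False using \<pi> coeff_polys[OF q(1)] by (auto simp: unit_on_def)
  qed
  have iff: "dvd_on (polys A) [:\<pi>:] f \<longleftrightarrow> (\<forall>i. dvd_on A \<pi> (coeff f i))" for f
  proof
    show "\<forall>i. dvd_on A \<pi> (coeff f i) \<Longrightarrow> dvd_on (polys A) [:\<pi>:] f"
      using dvd_coeffs_imp[OF \<pi>(2), of f] by (auto simp: dvd_on_def)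
  qed (auto simp: dvd_on_def coeff_polys)
  fix x y assume "x \<in> polys A" "y \<in> polys A" "dvd_on (polys A) [:\<pi>:] (x * y)"
  then show "dvd_on (polys A) [:\<pi>:] x \<or> dvd_on (polys A) [:\<pi>:] y"
    using prime_dvd_coeffs[OF assms] unfolding iff by blast
qed

text \<open>
  The content of a polynomial is a product of primes of \<open>A\<close>, which remain prime. A primitive
  polynomial that is reducible has two factors of smaller degree, because primitive constants are
  units.
\<close>
theorem factorial_on_polys:
  assumes fact: "factorial_on A"
  shows "factorial_on (polys A)"
proof -
  interpret P: type_subdomain "polys A" ..
  have const: "[:c:] \<in> prime_prods (polys A)" if "c \<in> prime_prods A" for c
    using that
  proof (induction rule: prime_prods.induct)
    case (mult p x)
    then show ?case
      using prime_prods.mult[OF prime_const_polys[OF mult(1)] mult.IH] by (simp add: mult.commute)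
  qed (auto intro: prime_prods.unit unit_polys_const)
  have const_unit: "unit_on (polys A) q" if q: "q \<in> polys A" "q \<noteq> 0" "degree q = 0" "primitive_on A q" for q
  proof -
    obtain k where k: "q = [:k:]" using degree_eq_zeroE[OF q(3)] by blast
    then have "k \<in> A" "k \<noteq> 0" using q coeff_polys[OF q(1), of 0] by auto
    then have "k \<in> prime_prods A" using fact by (auto simp: factorial_on_def)
    then show ?thesis
    proof cases
      case unit
      then show ?thesis using k unit_polys_const by blast
    next
      case (mult \<pi> x)
      have "dvd_on A \<pi> (coeff q i)" for i
        using mult k prime_prods_carrier dvd_zero by (cases i) (auto simp: dvd_on_def)
      then show ?thesis using q(4) mult by (auto simp: primitive_on_def)
    qed
  qed
  have prim: "z \<in> prime_prods (polys A)" if "z \<in> polys A" "z \<noteq> 0" "primitive_on A z" for z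
    using that
  proof (induction "degree z" arbitrary: z rule: less_induct)
    case (less z)
    show ?case
    proof (cases "unit_on (polys A) z")
      case nu: False
      show ?thesis
      proof (cases "\<forall>q\<in>polys A. \<forall>r\<in>polys A. z = q * r \<longrightarrow> unit_on (polys A) q \<or> unit_on (polys A) r")
        case True
        then have "prime_on (polys A) z"
          using irreducible_imp_prime_polys[OF fact less(2,3) nu less(4)] by blast
        then show ?thesis
          using prime_prods.mult[OF _ prime_prods.unit[OF P.unit_one]] by fastforce
      next
        case False
        then obtain q r where qr: "q \<in> polys A" "r \<in> polys A" "z = q * r"
          "\<not> unit_on (polys A) q" "\<not> unit_on (polys A) r" by blast
        then have nz: "q \<noteq> 0" "r \<noteq> 0" using less(3) by auto
        have "dvd_on A \<pi> (coeff z i)" if "\<forall>i. dvd_on A \<pi> (coeff q i)" for \<pi> i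
          unfolding qr(3) coeff_mult
          using that coeff_polys[OF qr(2)] by (intro dvd_sum dvd_mult_right) auto
        then have "primitive_on A q"
          using less(4) unfolding primitive_on_def by blast
        moreover have "dvd_on A \<pi> (coeff z i)" if "\<forall>i. dvd_on A \<pi> (coeff r i)" for \<pi> i
          unfolding qr(3) coeff_mult
          using that coeff_polys[OF qr(1)] by (intro dvd_sum dvd_mult_left) auto
        then have "primitive_on A r"
          using less(4) unfolding primitive_on_def by blast
        moreover from calculation this have "degree q > 0" "degree r > 0"
          using const_unit qr nz by blast+
        moreover have "degree z = degree q + degree r" using degree_mult_eq[OF nz] qr(3) by simp
        ultimately have "q \<in> prime_prods (polys A)" "r \<in> prime_prods (polys A)"
          using less(1) qr nz by auto
        then show ?thesis using P.prime_prods_mult qr(3) by blast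
      qed
    qed (rule prime_prods.unit)
  qed
  show ?thesis
    unfolding factorial_on_def
  proof (intro ballI impI)
    fix z assume z: "z \<in> polys A" "z \<noteq> 0"
    then have "lead_coeff z \<in> prime_prods A" using fact coeff_polys[OF z(1)] by (auto simp: factorial_on_def)
    then obtain c z' where c: "c \<in> prime_prods A" "z' \<in> polys A" "z = smult c z'" "primitive_on A z'"
      using content_exists[OF z(1)] by blast
    then have "z' \<in> prime_prods (polys A)" using prim z by auto
    then have "[:c:] * z' \<in> prime_prods (polys A)" using P.prime_prods_mult const[OF c(1)] by blast
    then show "z \<in> prime_prods (polys A)" using c by simp
  qed
qed

end

section \<open>Polynomial rings in finitely many variables\<close>

lemma gen_image_hom:
  assumes "\<And>x y. \<phi> (x + y) = \<phi> x + \<phi> y" "\<And>x y. \<phi> (x * y) = \<phi> x * \<phi> y" "\<phi> 0 = 0"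
    and "y \<in> gen A G"
  shows "\<phi> y \<in> gen (\<phi> ` A) (\<phi> ` G)"
  using assms(4) by (induction rule: gen.induct) (auto simp: assms(1-3) intro: gen.intros)

lemma noetherian_on_image:
  fixes \<phi> :: "'b::comm_ring_1 \<Rightarrow> 'a::comm_ring_1"
  assumes hom: "\<And>x y. \<phi> (x + y) = \<phi> x + \<phi> y" "\<And>x y. \<phi> (x * y) = \<phi> x * \<phi> y" "\<phi> 0 = 0"
    and B: "type_subring B" and A: "type_subring (\<phi> ` B)" and noeth: "noetherian_on B"
  shows "noetherian_on (\<phi> ` B)"
  unfolding noetherian_on_def
proof (intro allI impI)
  interpret B: type_subring B by (rule B)
  interpret A: type_subring "\<phi> ` B" by (rule A)
  fix J assume J: "ideal J (ring_on (\<phi> ` B))"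
  note JD = A.ideal_onD[OF J]
  define J' where "J' = {x \<in> B. \<phi> x \<in> J}"
  have "ideal J' (ring_on B)"
    unfolding B.ideal_on_iff J'_def using JD B.zero_mem B.add_mem B.mult_mem by (auto simp: hom)
  then obtain G where G: "G \<subseteq> J'" "finite G" "J' = gen B G"
    using noetherian_onD[OF noeth] by metis
  have "J \<subseteq> gen (\<phi> ` B) (\<phi> ` G)"
  proof
    fix y assume y: "y \<in> J"
    then obtain x where "x \<in> B" "y = \<phi> x" using JD(1) by blast
    then have "x \<in> gen B G" using y G(3) by (auto simp: J'_def)
    then show "y \<in> gen (\<phi> ` B) (\<phi> ` G)"
      using gen_image_hom[OF hom, of x B G] \<open>y = \<phi> x\<close> by blast
  qed
  moreover have "\<phi> ` G \<subseteq> J" using G(1) by (auto simp: J'_def)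
  ultimately show "\<exists>G \<subseteq> J. finite G \<and> J = gen (\<phi> ` B) G"
    using A.gen_subset[OF J, of "\<phi> ` G"] G(2) by (intro exI[of _ "\<phi> ` G"]) auto
qed

lemma factorial_on_image:
  fixes \<phi> :: "'b::idom \<Rightarrow> 'a::idom"
  assumes hom: "\<And>x y. \<phi> (x * y) = \<phi> x * \<phi> y" "\<phi> 0 = 0" "\<phi> 1 = 1"
    and inj: "inj_on \<phi> B"
    and B: "type_subring B" and fact: "factorial_on B"
  shows "factorial_on (\<phi> ` B)"
proof -
  interpret B: type_subring B by (rule B)
  have eq: "\<phi> x = \<phi> y \<longleftrightarrow> x = y" if "x \<in> B" "y \<in> B" for x y
    using inj that by (auto simp: inj_on_def)
  have unit_iff: "unit_on (\<phi> ` B) (\<phi> u) \<longleftrightarrow> unit_on B u" if "u \<in> B" for u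
  proof -
    have "\<phi> u * \<phi> v = 1 \<longleftrightarrow> u * v = 1" if "v \<in> B" for v
      using eq[of "u * v" 1] B.mult_mem B.one_mem that \<open>u \<in> B\<close> by (simp add: hom)
    then show ?thesis using that by (auto simp: unit_on_def)
  qed
  have dvd: "dvd_on (\<phi> ` B) (\<phi> a) (\<phi> b) \<longleftrightarrow> dvd_on B a b" if "a \<in> B" "b \<in> B" for a b
  proof -
    have "\<phi> b = \<phi> a * \<phi> c \<longleftrightarrow> b = a * c" if "c \<in> B" for c
      using eq[of b "a * c"] B.mult_mem that \<open>a \<in> B\<close> \<open>b \<in> B\<close> by (simp add: hom)
    then show ?thesis by (auto simp: dvd_on_def)
  qed
  have prime: "prime_on (\<phi> ` B) (\<phi> p)" if "prime_on B p" for p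
  proof -
    note p = prime_onD[OF that]
    have "\<phi> p \<noteq> 0" using eq[of p 0] p B.zero_mem by (simp add: hom)
    moreover have "dvd_on (\<phi> ` B) (\<phi> p) (\<phi> x) \<or> dvd_on (\<phi> ` B) (\<phi> p) (\<phi> y)"
      if "x \<in> B" "y \<in> B" "dvd_on (\<phi> ` B) (\<phi> p) (\<phi> x * \<phi> y)" for x y
      using that p(4)[of x y] dvd[OF p(1)] B.mult_mem by (simp flip: hom(1))
    ultimately show ?thesis
      using p unit_iff by (auto simp: prime_on_def)
  qed
  have prods: "\<phi> x \<in> prime_prods (\<phi> ` B)" if "x \<in> prime_prods B" for x
    using that
  proof (induction rule: prime_prods.induct)
    case (unit u)
    then have "u \<in> B" by (simp add: unit_on_def)
    with unit show ?case using prime_prods.unit unit_iff by blast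
  next
    case (mult p x)
    then show ?case using prime_prods.mult[OF prime] by (simp add: hom)
  qed
  show ?thesis
    unfolding factorial_on_def using fact prods by (auto simp: factorial_on_def hom)
qed

type_synonym 'k mpoly = "(nat \<Rightarrow>\<^sub>0 nat) \<Rightarrow>\<^sub>0 'k"

definition mpolys :: "nat \<Rightarrow> 'k::field mpoly set"
  where "mpolys n = {p. \<forall>t \<in> Poly_Mapping.keys p. Poly_Mapping.keys t \<subseteq> {..<n}}"

lemma mpoly_ring_eq: "mpoly_ring n = ring_on (mpolys n)"
  by (simp add: mpoly_ring_def mpolys_def)

lemma single_mem_mpolys: "Poly_Mapping.keys t \<subseteq> {..<n} \<Longrightarrow> Poly_Mapping.single t c \<in> mpolys n"
  by (auto simp: mpolys_def split: if_splits)

lemma mpolys_subring: "type_subring (mpolys n :: 'k::field mpoly set)"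
proof
  show "x - y \<in> mpolys n" if "x \<in> mpolys n" "y \<in> mpolys n" for x y :: "'k mpoly"
    using that keys_diff[of x y] by (auto simp: mpolys_def)
  show "x * y \<in> mpolys n" if "x \<in> mpolys n" "y \<in> mpolys n" for x y :: "'k mpoly"
  proof -
    have "Poly_Mapping.keys (a + b) \<subseteq> {..<n}"
      if "a \<in> Poly_Mapping.keys x" "b \<in> Poly_Mapping.keys y" for a b
      using that \<open>x \<in> mpolys n\<close> \<open>y \<in> mpolys n\<close> Poly_Mapping.keys_add[of a b]
      unfolding mpolys_def by blast
    then show ?thesis using keys_mult[of x y] unfolding mpolys_def by blast
  qed
qed (simp add: mpolys_def)

interpretation mp: type_subring "mpolys n :: 'k::field mpoly set" for n
  by (rule mpolys_subring)

interpretation mpd: type_subdomain "mpolys n :: 'k::field mpoly set" for n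
  by unfold_locales

lemma mpoly_expand: "p = (\<Sum>t\<in>Poly_Mapping.keys p. Poly_Mapping.single t (Poly_Mapping.lookup p t))"
proof (rule poly_mapping_eqI)
  fix k
  show "Poly_Mapping.lookup p k = Poly_Mapping.lookup
      (\<Sum>t\<in>Poly_Mapping.keys p. Poly_Mapping.single t (Poly_Mapping.lookup p t)) k"
    by (auto simp: lookup_sum lookup_single when_def sum.delta in_keys_iff)
qed

lemma mpoly_induct [case_names zero single add]:
  assumes "P 0" "\<And>t c. P (Poly_Mapping.single t c)" "\<And>p q. P p \<Longrightarrow> P q \<Longrightarrow> P (p + q)"
  shows "P (p :: 'a \<Rightarrow>\<^sub>0 'b::comm_monoid_add)"
proof -
  have "P (\<Sum>t\<in>F. Poly_Mapping.single t (Poly_Mapping.lookup p t))" for F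
    by (induction F rule: infinite_finite_induct) (auto intro: assms)
  then show ?thesis using mpoly_expand[of p] by metis
qed

text \<open>The residue class of \<open>p\<close> modulo the graded maximal ideal, as an element of the field.\<close>
abbreviation const_coeff :: "'k::field mpoly \<Rightarrow> 'k"
  where "const_coeff p \<equiv> Poly_Mapping.lookup p 0"

lemma monomial_add_eq_0_iff: "(s + t = 0) = (s = 0 \<and> t = 0)" for s t :: "nat \<Rightarrow>\<^sub>0 nat"
  by (auto simp: poly_mapping_eq_iff lookup_add fun_eq_iff)

lemma const_coeff_mult: "const_coeff (p * q) = const_coeff p * const_coeff q"
proof (induction p rule: mpoly_induct)
  case (single s a)
  show ?case
  proof (induction q rule: mpoly_induct)
    case (single t b)
    show ?case using monomial_add_eq_0_iff[of s t] by (auto simp: mult_single lookup_single when_def)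
  qed (auto simp: lookup_add algebra_simps)
qed (auto simp: lookup_add algebra_simps)

abbreviation const_mpoly :: "'k::field \<Rightarrow> 'k mpoly"
  where "const_mpoly c \<equiv> Poly_Mapping.single 0 c"

lemma const_mpoly_mem: "const_mpoly c \<in> mpolys n"
  by (rule single_mem_mpolys) simp

lemma mpolys_0: "(mpolys 0 :: 'k::field mpoly set) = range const_mpoly"
proof
  show "mpolys 0 \<subseteq> (range const_mpoly :: 'k mpoly set)"
  proof
    fix p :: "'k mpoly" assume "p \<in> mpolys 0"
    then have "Poly_Mapping.keys p \<subseteq> {0}" by (auto simp: mpolys_def)
    then have "p = const_mpoly (const_coeff p)"
      by (intro poly_mapping_eqI) (auto simp: lookup_single when_def in_keys_iff)
    then show "p \<in> range const_mpoly" by blast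
  qed
qed (auto intro: const_mpoly_mem)

lemma unit_const_mpoly: "c \<noteq> 0 \<Longrightarrow> unit_on (mpolys n) (const_mpoly c)"
  unfolding unit_on_def
  by (intro conjI bexI[of _ "const_mpoly (inverse c)"]) (auto simp: mult_single const_mpoly_mem)

lemma factorial_mpolys_0: "factorial_on (mpolys 0 :: 'k::field mpoly set)"
  unfolding factorial_on_def
proof (intro ballI impI)
  fix a :: "'k mpoly" assume "a \<in> mpolys 0" "a \<noteq> 0"
  then obtain c where "a = const_mpoly c" by (auto simp: mpolys_0)
  moreover from this have "c \<noteq> 0" using \<open>a \<noteq> 0\<close> by auto
  ultimately show "a \<in> prime_prods (mpolys 0)" by (auto intro: prime_prods.unit unit_const_mpoly)
qed

lemma noetherian_mpolys_0: "noetherian_on (mpolys 0 :: 'k::field mpoly set)"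
  unfolding noetherian_on_def
proof (intro allI impI)
  fix J :: "'k mpoly set" assume J: "ideal J (ring_on (mpolys 0))"
  note JD = mp.ideal_onD[OF J]
  show "\<exists>G\<subseteq>J. finite G \<and> J = gen (mpolys 0) G"
  proof (cases "J = {0}")
    case True
    then show ?thesis
      using mp.gen_subset[OF J, of J] mp.gen_self[of J 0] by (intro exI[of _ J]) auto
  next
    case False
    then obtain a where a: "a \<in> J" "a \<noteq> 0" using JD(2) by blast
    then obtain c where c: "a = const_mpoly c" using JD(1)[OF a(1)] by (auto simp: mpolys_0)
    with a have "c \<noteq> 0" by auto
    have "J \<subseteq> gen (mpolys 0) {a}"
    proof
      fix x assume "x \<in> J"
      then have "x * const_mpoly (inverse c) \<in> mpolys 0" using JD(1) mp.mult_mem const_mpoly_mem by blast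
      then have "x * const_mpoly (inverse c) * a + 0 \<in> gen (mpolys 0) {a}"
        by (intro gen.intros) auto
      moreover have "x * const_mpoly (inverse c) * a + 0 = x"
        using \<open>c \<noteq> 0\<close> unfolding c mult.assoc by (simp add: mult_single)
      ultimately show "x \<in> gen (mpolys 0) {a}" by metis
    qed
    then show ?thesis
      using mp.gen_subset[OF J, of "{a}"] a by (intro exI[of _ "{a}"]) auto
  qed
qed

lemma mpoly_var_power: "mpoly_var i ^ e = Poly_Mapping.single (Poly_Mapping.single i e) 1"
  by (induction e) (auto simp: mpoly_var_def mult_single simp flip: single_add)

lemma var_mem: "i < n \<Longrightarrow> mpoly_var i \<in> mpolys n"
  unfolding mpoly_var_def by (rule single_mem_mpolys) auto

lemma mpolys_mono: "n \<le> m \<Longrightarrow> mpolys n \<subseteq> mpolys m"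
  unfolding mpolys_def by fastforce

lemma monomial_split_unique:
  fixes t k :: "nat \<Rightarrow>\<^sub>0 nat"
  assumes "Poly_Mapping.keys t \<subseteq> {..<n}" "Poly_Mapping.keys k \<subseteq> {..<n}"
  shows "k + Poly_Mapping.single n i = t + Poly_Mapping.single n e \<longleftrightarrow> k = t \<and> i = e"
proof
  assume eq: "k + Poly_Mapping.single n i = t + Poly_Mapping.single n e"
  have "n \<notin> Poly_Mapping.keys k" "n \<notin> Poly_Mapping.keys t" using assms by auto
  then have "Poly_Mapping.lookup k n = 0" "Poly_Mapping.lookup t n = 0"
    by (simp_all add: in_keys_iff)
  then have "i = e"
    using arg_cong[OF eq, of "\<lambda>f. Poly_Mapping.lookup f n"] by (simp add: lookup_add)
  then show "k = t \<and> i = e" using eq by simp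
qed simp

lemma lookup_mult_var_power:
  assumes t: "Poly_Mapping.keys t \<subseteq> {..<n}" and q: "q \<in> mpolys n"
  shows "Poly_Mapping.lookup (q * mpoly_var n ^ i) (t + Poly_Mapping.single n e) =
    (if i = e then Poly_Mapping.lookup q t else 0)"
proof -
  have "Poly_Mapping.lookup (q * mpoly_var n ^ i) (t + Poly_Mapping.single n e) =
      (\<Sum>k\<in>Poly_Mapping.keys q. Poly_Mapping.lookup
        (Poly_Mapping.single (k + Poly_Mapping.single n i) (Poly_Mapping.lookup q k))
        (t + Poly_Mapping.single n e))"
    by (subst mpoly_expand[of q])
      (simp add: mpoly_var_power sum_distrib_right mult_single lookup_sum)
  also have "\<dots> = (\<Sum>k\<in>Poly_Mapping.keys q. if k = t then (if i = e then Poly_Mapping.lookup q t else 0) else 0)"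
  proof (rule sum.cong)
    fix k assume "k \<in> Poly_Mapping.keys q"
    then have "Poly_Mapping.keys k \<subseteq> {..<n}" using q by (auto simp: mpolys_def)
    then show "Poly_Mapping.lookup
        (Poly_Mapping.single (k + Poly_Mapping.single n i) (Poly_Mapping.lookup q k))
        (t + Poly_Mapping.single n e) = (if k = t then (if i = e then Poly_Mapping.lookup q t else 0) else 0)"
      using monomial_split_unique[OF t, of k i e] by (auto simp: lookup_single when_def)
  qed simp
  also have "\<dots> = (if i = e then Poly_Mapping.lookup q t else 0)"
    by (auto simp: in_keys_iff)
  finally show ?thesis .
qed

text \<open>
  A monomial in the variables up to \<open>x\<^sub>n\<close> splits uniquely into a monomial \<open>t\<close> in the earlier variables
  and a power of \<open>x\<^sub>n\<close>. So the coefficients of \<open>p\<close> can be recovered from the value of \<open>p\<close> at \<open>x\<^sub>n\<close>.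
\<close>
lemma poly_var_lookup:
  assumes t: "Poly_Mapping.keys t \<subseteq> {..<n}" and p: "p \<in> polys (mpolys n)"
  shows "Poly_Mapping.lookup (poly p (mpoly_var n)) (t + Poly_Mapping.single n e) =
    Poly_Mapping.lookup (coeff p e) t"
proof -
  have "Poly_Mapping.lookup (poly p (mpoly_var n)) (t + Poly_Mapping.single n e) =
    (\<Sum>i\<le>degree p. if i = e then Poly_Mapping.lookup (coeff p e) t else 0)"
    unfolding poly_altdef lookup_sum
    by (intro sum.cong refl) (simp add: lookup_mult_var_power[OF t coeff_polys[OF p]])
  then show ?thesis using coeff_eq_0[of p e] by (auto simp: not_le)
qed

lemma inj_poly_var: "inj_on (\<lambda>p. poly p (mpoly_var n)) (polys (mpolys n :: 'k::field mpoly set))"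
proof (rule inj_onI)
  fix p q :: "'k mpoly poly"
  assume p: "p \<in> polys (mpolys n)" and q: "q \<in> polys (mpolys n)"
    and eq: "poly p (mpoly_var n) = poly q (mpoly_var n)"
  show "p = q"
  proof (intro poly_eqI poly_mapping_eqI)
    fix e t
    show "Poly_Mapping.lookup (coeff p e) t = Poly_Mapping.lookup (coeff q e) t"
    proof (cases "Poly_Mapping.keys t \<subseteq> {..<n}")
      case True
      then show ?thesis using poly_var_lookup[OF True p, of e] poly_var_lookup[OF True q, of e] eq by simp
    next
      case False
      then have "t \<notin> Poly_Mapping.keys (coeff p e)" "t \<notin> Poly_Mapping.keys (coeff q e)"
        using coeff_polys[OF p, of e] coeff_polys[OF q, of e] by (auto simp: mpolys_def)
      then show ?thesis by (simp add: in_keys_iff)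
    qed
  qed
qed

lemma poly_var_image:
  "(\<lambda>p. poly p (mpoly_var n)) ` polys (mpolys n) = (mpolys (Suc n) :: 'k::field mpoly set)" (is "?\<phi> ` _ = _")
proof
  show "?\<phi> ` polys (mpolys n) \<subseteq> (mpolys (Suc n) :: 'k mpoly set)"
  proof safe
    fix p :: "'k mpoly poly" assume p: "p \<in> polys (mpolys n)"
    have "coeff p i \<in> mpolys (Suc n)" for i
      using coeff_polys[OF p] mpolys_mono[of n "Suc n"] by auto
    then show "poly p (mpoly_var n) \<in> mpolys (Suc n)"
      unfolding poly_altdef by (intro mp.sum_mem mp.mult_mem mp.power_mem var_mem) auto
  qed
  show "mpolys (Suc n) \<subseteq> ?\<phi> ` polys (mpolys n :: 'k mpoly set)"
  proof
    fix q :: "'k mpoly" assume q: "q \<in> mpolys (Suc n)"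
    have ex: "\<exists>f \<in> polys (mpolys n). poly f (mpoly_var n) = Poly_Mapping.single t (Poly_Mapping.lookup q t)"
      if t: "t \<in> Poly_Mapping.keys q" for t
    proof -
      define e where "e = Poly_Mapping.lookup t n"
      define t' where "t' = t - Poly_Mapping.single n e"
      have look: "Poly_Mapping.lookup t' i = (if i = n then 0 else Poly_Mapping.lookup t i)" for i
        by (auto simp: t'_def e_def lookup_minus lookup_single when_def)
      have "t = t' + Poly_Mapping.single n e"
        by (rule poly_mapping_eqI) (auto simp: lookup_add look lookup_single e_def when_def)
      moreover have "Poly_Mapping.keys t \<subseteq> {..<Suc n}" using q t by (auto simp: mpolys_def)
      then have "i < Suc n" if "Poly_Mapping.lookup t i \<noteq> 0" for i
        using that subsetD[of _ "{..<Suc n}" i] by (auto simp: in_keys_iff)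
      then have "i < n" if "Poly_Mapping.lookup t' i \<noteq> 0" for i
        using that look[of i] by (cases "i = n") (auto simp: less_Suc_eq)
      then have "Poly_Mapping.keys t' \<subseteq> {..<n}"
        by (auto simp: in_keys_iff)
      then have "monom (Poly_Mapping.single t' (Poly_Mapping.lookup q t)) e \<in> polys (mpolys n)"
        by (intro mp.monom_mem single_mem_mpolys)
      ultimately show ?thesis
        by (intro bexI[of _ "monom (Poly_Mapping.single t' (Poly_Mapping.lookup q t)) e"])
          (simp_all add: poly_monom mpoly_var_power mult_single)
    qed
    then obtain f where f: "\<And>t. t \<in> Poly_Mapping.keys q \<Longrightarrow> f t \<in> polys (mpolys n)"
      "\<And>t. t \<in> Poly_Mapping.keys q \<Longrightarrow> poly (f t) (mpoly_var n) = Poly_Mapping.single t (Poly_Mapping.lookup q t)"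
      by metis
    interpret P: type_subring "polys (mpolys n :: 'k mpoly set)" by (rule mp.type_subring_polys)
    have "poly (\<Sum>t\<in>Poly_Mapping.keys q. f t) (mpoly_var n) = q"
      using f(2) by (simp add: poly_sum flip: mpoly_expand)
    moreover have "(\<Sum>t\<in>Poly_Mapping.keys q. f t) \<in> polys (mpolys n)"
      using f(1) by (intro P.sum_mem)
    ultimately show "q \<in> ?\<phi> ` polys (mpolys n)" by force
  qed
qed

theorem factorial_mpolys: "factorial_on (mpolys n :: 'k::field mpoly set)"
proof (induction n)
  case (Suc n)
  show ?case
    unfolding poly_var_image[symmetric]
    by (rule factorial_on_image)
      (auto simp: inj_poly_var mp.type_subring_polys mpd.factorial_on_polys[OF Suc])
qed (rule factorial_mpolys_0)

theorem noetherian_mpolys: "noetherian_on (mpolys n :: 'k::field mpoly set)"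
proof (induction n)
  case (Suc n)
  have "noetherian_on ((\<lambda>p. poly p (mpoly_var n)) ` polys (mpolys n :: 'k mpoly set))"
    by (rule noetherian_on_image)
      (auto simp: mp.type_subring_polys mp.hilbert_basis[OF Suc] poly_var_image mpolys_subring)
  then show ?case by (simp add: poly_var_image)
qed (rule noetherian_mpolys_0)

section \<open>Minimal homogeneous generators and the graded Nakayama lemma\<close>

definition mdeg :: "(nat \<Rightarrow>\<^sub>0 nat) \<Rightarrow> nat"
  where "mdeg t = (\<Sum>i\<in>Poly_Mapping.keys t. Poly_Mapping.lookup t i)"

lemma mdeg_add: "mdeg (s + t) = mdeg s + mdeg t"
  unfolding mdeg_def by (rule setsum_keys_plus_distrib) auto

lemma mdeg_eq_0_iff: "mdeg t = 0 \<longleftrightarrow> t = 0"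
  by (auto simp: mdeg_def in_keys_iff poly_mapping_eq_iff fun_eq_iff)

lemma homogeneous_iff: "homogeneous d p \<longleftrightarrow> (\<forall>t \<in> Poly_Mapping.keys p. mdeg t = d)"
  by (simp add: homogeneous_def mdeg_def)

lemma homogeneous_mult: "homogeneous d p \<Longrightarrow> homogeneous e q \<Longrightarrow> homogeneous (d + e) (p * q)"
  using keys_mult[of p q] by (fastforce simp: homogeneous_iff mdeg_add)

text \<open>The substitution \<open>x\<^sub>i \<mapsto> x\<^sub>i t\<close>, whose coefficients are the homogeneous components.\<close>
definition components :: "'k::field mpoly \<Rightarrow> 'k mpoly poly"
  where "components p =
    (\<Sum>t\<in>Poly_Mapping.keys p. monom (Poly_Mapping.single t (Poly_Mapping.lookup p t)) (mdeg t))"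

lemma components_zero: "components 0 = 0"
  by (simp add: components_def)

lemma components_single: "components (Poly_Mapping.single t c) = monom (Poly_Mapping.single t c) (mdeg t)"
  by (simp add: components_def)

lemma components_add: "components (p + q) = components p + components q"
  unfolding components_def
  by (rule setsum_keys_plus_distrib) (auto simp: single_add add_monom)

lemma components_sum: "components (sum f F) = (\<Sum>i\<in>F. components (f i))"
  by (induction F rule: infinite_finite_induct) (auto simp: components_zero components_add)

lemma components_mult: "components (p * q) = components p * components q"
proof (induction p rule: mpoly_induct)
  case (single s a)
  show ?case
    by (induction q rule: mpoly_induct)
      (auto simp: components_zero components_add components_single mult_single mult_monom mdeg_add algebra_simps)
qed (auto simp: components_zero components_add algebra_simps)

lemma components_homogeneous:
  assumes "homogeneous d p"
  shows "components p = monom p d"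
proof -
  have "components p = (\<Sum>t\<in>Poly_Mapping.keys p. monom (Poly_Mapping.single t (Poly_Mapping.lookup p t)) d)"
    unfolding components_def using assms by (intro sum.cong) (auto simp: homogeneous_iff)
  also have "\<dots> = monom (\<Sum>t\<in>Poly_Mapping.keys p. Poly_Mapping.single t (Poly_Mapping.lookup p t)) d"
    by (simp add: poly_eq_iff coeff_sum)
  finally show ?thesis by (simp flip: mpoly_expand)
qed

lemma coeff_components_mem:
  assumes "p \<in> mpolys n"
  shows "coeff (components p) i \<in> mpolys n"
  unfolding components_def coeff_sum
  using assms by (intro mp.sum_mem) (auto simp: mp.zero_mem mpolys_def split: if_splits)

lemma coeff_components_0: "coeff (components p) 0 = const_mpoly (const_coeff p)"
  by (induction p rule: mpoly_induct)
    (auto simp: components_zero components_add components_single mdeg_eq_0_iff lookup_single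
      lookup_add single_add when_def)

definition max_ideal :: "nat \<Rightarrow> 'k::field mpoly set"
  where "max_ideal n = {p \<in> mpolys n. const_coeff p = 0}"

lemma ideal_max_ideal: "ideal (max_ideal n :: 'k::field mpoly set) (ring_on (mpolys n))"
  unfolding mp.ideal_on_iff max_ideal_def
  by (auto simp: mp.zero_mem mp.add_mem mp.mult_mem lookup_add const_coeff_mult)

lemma graded_max_eq: "graded_max n = (max_ideal n :: 'k::field mpoly set)"
proof -
  have var: "mpoly_var ` {..<n} \<subseteq> (mpolys n :: 'k mpoly set)" by (auto intro: var_mem)
  have nz: "Poly_Mapping.single i (Suc 0) \<noteq> 0" for i :: nat
    by (metis lookup_single_eq lookup_zero nat.distinct(1))
  have "graded_max n = gen (mpolys n) (mpoly_var ` {..<n} :: 'k mpoly set)"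
    by (simp add: graded_max_def mpoly_ring_eq mp.Idl_eq_gen[OF var])
  also have "\<dots> = max_ideal n"
  proof
    show "gen (mpolys n) (mpoly_var ` {..<n}) \<subseteq> (max_ideal n :: 'k mpoly set)"
      using var by (intro mp.gen_subset[OF ideal_max_ideal])
        (auto simp: max_ideal_def mpoly_var_def lookup_single when_def nz)
    show "max_ideal n \<subseteq> gen (mpolys n) (mpoly_var ` {..<n} :: 'k mpoly set)" (is "_ \<subseteq> ?G")
    proof
      fix p :: "'k mpoly" assume p: "p \<in> max_ideal n"
      have "Poly_Mapping.single t (Poly_Mapping.lookup p t) \<in> ?G" if t: "t \<in> Poly_Mapping.keys p" for t
      proof -
        have "t \<noteq> 0" using p t by (auto simp: max_ideal_def in_keys_iff)
        then obtain i where i: "i \<in> Poly_Mapping.keys t"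
          by (metis keys_eq_empty all_not_in_conv)
        have tn: "Poly_Mapping.keys t \<subseteq> {..<n}" using p t by (auto simp: max_ideal_def mpolys_def)
        define t' where "t' = t - Poly_Mapping.single i 1"
        have t': "t = t' + Poly_Mapping.single i 1"
          using i by (intro poly_mapping_eqI)
            (auto simp: t'_def lookup_add lookup_minus lookup_single when_def in_keys_iff)
        have "Poly_Mapping.keys t' \<subseteq> Poly_Mapping.keys t"
          by (auto simp: t'_def in_keys_iff lookup_minus)
        then have "Poly_Mapping.single t' (Poly_Mapping.lookup p t) \<in> mpolys n"
          using tn by (intro single_mem_mpolys) auto
        then have "Poly_Mapping.single t' (Poly_Mapping.lookup p t) * mpoly_var i + 0 \<in> ?G"
          using i tn by (intro gen.intros) auto
        moreover have "Poly_Mapping.single t' (Poly_Mapping.lookup p t) * mpoly_var i =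
            Poly_Mapping.single t (Poly_Mapping.lookup p t)"
          by (simp only: mpoly_var_def mult_single mult_1_right t'[symmetric])
        ultimately show ?thesis by simp
      qed
      then have "(\<Sum>t\<in>Poly_Mapping.keys p. Poly_Mapping.single t (Poly_Mapping.lookup p t)) \<in> ?G"
        by (rule mp.ideal_onD(6)[OF mp.ideal_gen[OF var]])
      then show "p \<in> ?G" by (simp flip: mpoly_expand)
    qed
  qed
  finally show ?thesis .
qed

text \<open>
  The generators are indexed, with repetitions allowed, so that they can label the rows and columns
  of matrices.
\<close>
definition homog_gens :: "nat \<Rightarrow> 'k::field mpoly set \<Rightarrow> nat \<Rightarrow> (nat \<Rightarrow> 'k mpoly) \<Rightarrow> bool"
  where "homog_gens n L r b \<longleftrightarrow>
    (\<forall>j<r. b j \<in> mpolys n \<and> (\<exists>d. homogeneous d (b j))) \<and> gen (mpolys n) (b ` {..<r}) = L"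

definition min_homog_gens :: "nat \<Rightarrow> 'k::field mpoly set \<Rightarrow> nat \<Rightarrow> (nat \<Rightarrow> 'k mpoly) \<Rightarrow> bool"
  where "min_homog_gens n L r b \<longleftrightarrow> homog_gens n L r b \<and> (\<forall>r' b'. homog_gens n L r' b' \<longrightarrow> r \<le> r')"

lemma min_homog_gens_exists: "homog_gens n L r b \<Longrightarrow> \<exists>r b. min_homog_gens n L r b"
proof -
  assume "homog_gens n L r b"
  then have ex: "\<exists>r b. homog_gens n L r b" by blast
  define r where "r = (LEAST r. \<exists>b. homog_gens n L r b)"
  have "\<exists>b. homog_gens n L r b" unfolding r_def by (rule LeastI_ex[OF ex])
  then show ?thesis
    unfolding min_homog_gens_def using Least_le[of "\<lambda>r. \<exists>b. homog_gens n L r b"] r_def by blast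
qed

lemma homog_gens_subset: "homog_gens n L r b \<Longrightarrow> b ` {..<r} \<subseteq> mpolys n"
  by (auto simp: homog_gens_def)

lemma homog_gens_of_finite:
  assumes "finite B" "B \<subseteq> mpolys n" "\<And>b. b \<in> B \<Longrightarrow> \<exists>d. homogeneous d b"
  shows "\<exists>r b. homog_gens n (gen (mpolys n) B) r b"
proof -
  obtain h where h: "bij_betw h {0..<card B} B" using ex_bij_betw_nat_finite[OF assms(1)] by blast
  then have im: "h ` {..<card B} = B" by (simp add: bij_betw_def atLeast0LessThan)
  then have "homog_gens n (gen (mpolys n) B) (card B) h"
    unfolding homog_gens_def im using assms im by (auto dest!: equalityD1)
  then show ?thesis by blast
qed

lemma sum_mem_gen:
  assumes "\<And>j. j \<in> F \<Longrightarrow> c j \<in> mpolys n" "b ` F \<subseteq> mpolys n"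
  shows "(\<Sum>j\<in>F. c j * b j) \<in> gen (mpolys n) (b ` F)"
proof (rule mp.ideal_onD(6)[OF mp.ideal_gen[OF assms(2)]])
  fix j assume "j \<in> F"
  then show "c j * b j \<in> gen (mpolys n) (b ` F)"
    using mp.gen_mult[OF assms(1)] mp.gen_self[of "b ` F" n] by auto
qed

text \<open>
  The graded Nakayama lemma. In the degree of \<open>b j0\<close> the relation reads \<open>\<Sum>\<^sub>j q\<^sub>j b\<^sub>j = 0\<close>, where
  \<open>q\<^sub>j\<close> is a homogeneous component of \<open>s j\<close> and \<open>q\<^sub>j\<^sub>0\<close> is the constant term of \<open>s j0\<close>. If the latter
  were nonzero, then \<open>b j0\<close> would be a combination of the other generators.
\<close>
lemma min_homog_gens_relation:
  assumes min: "min_homog_gens n L r b"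
    and s: "\<And>j. j < r \<Longrightarrow> s j \<in> mpolys n" and rel: "(\<Sum>j<r. s j * b j) = 0" and j0: "j0 < r"
  shows "const_coeff (s j0) = 0"
proof (rule ccontr)
  assume nz: "const_coeff (s j0) \<noteq> 0"
  have h: "homog_gens n L r b" using min by (simp add: min_homog_gens_def)
  note sub = homog_gens_subset[OF h]
  obtain e where e: "\<And>j. j < r \<Longrightarrow> homogeneous (e j) (b j)"
    using h unfolding homog_gens_def by metis
  define q where "q j = (if e j0 < e j then 0 else coeff (components (s j)) (e j0 - e j))" for j
  have q: "q j \<in> mpolys n" if "j < r" for j
    using coeff_components_mem[OF s[OF that]] mp.zero_mem by (auto simp: q_def)
  have "0 = coeff (components (\<Sum>j<r. s j * b j)) (e j0)"
    by (simp add: rel components_zero)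
  also have "\<dots> = (\<Sum>j<r. coeff (components (s j) * monom (b j) (e j)) (e j0))"
    unfolding components_sum coeff_sum
    by (intro sum.cong refl) (simp add: components_mult components_homogeneous[OF e])
  also have "\<dots> = (\<Sum>j<r. q j * b j)"
    by (intro sum.cong refl)
      (simp add: q_def coeff_monom_mult mult.commute[of _ "monom _ _"] mult.commute[of "b _"])
  also have "\<dots> = q j0 * b j0 + (\<Sum>j\<in>{..<r} - {j0}. q j * b j)"
    using j0 by (simp add: sum.remove)
  finally have "q j0 * b j0 = - (\<Sum>j\<in>{..<r} - {j0}. q j * b j)"
    by (simp add: eq_neg_iff_add_eq_0)
  moreover define c where "c = const_coeff (s j0)"
  have "q j0 = const_mpoly c"
    by (simp add: q_def coeff_components_0 c_def)
  ultimately have "const_mpoly (inverse c) * (const_mpoly c * b j0) =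
      const_mpoly (inverse c) * - (\<Sum>j\<in>{..<r} - {j0}. q j * b j)"
    by simp
  moreover have "const_mpoly (inverse c) * (const_mpoly c * b j0) = b j0"
    using nz by (simp add: c_def mult_single flip: mult.assoc)
  ultimately have "b j0 = (\<Sum>j\<in>{..<r} - {j0}. (const_mpoly (- inverse c) * q j) * b j)"
    by (simp add: single_uminus sum_distrib_left mult.assoc sum_negf)
  also have "\<dots> \<in> gen (mpolys n) (b ` ({..<r} - {j0}))"
    using q sub by (intro sum_mem_gen mp.mult_mem const_mpoly_mem) auto
  finally have b0: "b j0 \<in> gen (mpolys n) (b ` ({..<r} - {j0}))" .
  \<comment> \<open>the increasing enumeration of the indices other than \<open>j0\<close>\<close>
  define \<iota> where "\<iota> j = (if j < j0 then j else Suc j)" for j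
  have im: "\<iota> ` {..<r - 1} = {..<r} - {j0}"
  proof
    show "{..<r} - {j0} \<subseteq> \<iota> ` {..<r - 1}"
    proof
      fix j assume "j \<in> {..<r} - {j0}"
      then show "j \<in> \<iota> ` {..<r - 1}"
        using j0 by (intro image_eqI[of _ _ "if j < j0 then j else j - 1"]) (auto simp: \<iota>_def)
    qed
  qed (use j0 in \<open>auto simp: \<iota>_def\<close>)
  have "gen (mpolys n) ((b \<circ> \<iota>) ` {..<r - 1}) = L"
  proof -
    have "b ` {..<r} \<subseteq> gen (mpolys n) (b ` ({..<r} - {j0}))"
      using b0 mp.gen_self[of "b ` ({..<r} - {j0})" n] by blast
    then have "L \<subseteq> gen (mpolys n) (b ` ({..<r} - {j0}))"
      using h sub mp.gen_subset[OF mp.ideal_gen[of "b ` ({..<r} - {j0})" n], of "b ` {..<r}"]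
      by (auto simp: homog_gens_def)
    moreover have "gen (mpolys n) (b ` ({..<r} - {j0})) \<subseteq> L"
      using h gen_subset_mono[of "b ` ({..<r} - {j0})" "b ` {..<r}" "mpolys n"] by (auto simp: homog_gens_def)
    ultimately show ?thesis unfolding image_comp[symmetric] im by blast
  qed
  moreover have "b (\<iota> j) \<in> mpolys n \<and> (\<exists>d. homogeneous d (b (\<iota> j)))" if "j < r - 1" for j
    using h im that unfolding homog_gens_def by (auto simp: \<iota>_def)
  ultimately have "homog_gens n L (r - 1) (b \<circ> \<iota>)" by (simp add: homog_gens_def)
  then have "r \<le> r - 1" using min by (auto simp: min_homog_gens_def)
  then show False using j0 by simp
qed

text \<open>
  The identity matrix of size \<open>r\<close> has rank \<open>r\<close>, so it does not factor through dimension \<open>q < r\<close>: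
  after padding with zeros to square matrices, the left factor has a zero column.
\<close>
lemma identity_factor_le:
  fixes s t :: "nat \<Rightarrow> nat \<Rightarrow> 'k::idom"
  assumes "\<And>j l. j < r \<Longrightarrow> l < r \<Longrightarrow> (\<Sum>i<q. s j i * t i l) = (if j = l then 1 else 0)"
  shows "r \<le> q"
proof (rule ccontr)
  assume "\<not> r \<le> q"
  then have q: "q < r" by simp
  define S where "S = mat r r (\<lambda>(j, i). if i < q then s j i else 0)"
  define T where "T = mat r r (\<lambda>(i, l). t i l)"
  have carr: "S \<in> carrier_mat r r" "T \<in> carrier_mat r r" by (auto simp: S_def T_def)
  have "S * T = 1\<^sub>m r"
  proof (rule eq_matI)
    fix j l assume jl: "j < dim_row (1\<^sub>m r)" "l < dim_col (1\<^sub>m r)"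
    have "(S * T) $$ (j, l) = (\<Sum>i<r. (if i < q then s j i else 0) * t i l)"
      using jl by (simp add: S_def T_def scalar_prod_def atLeast0LessThan)
    also have "\<dots> = (\<Sum>i<q. s j i * t i l)"
      using q by (intro sum.mono_neutral_cong_right) auto
    finally show "(S * T) $$ (j, l) = 1\<^sub>m r $$ (j, l)" using assms jl by simp
  qed (simp_all add: S_def T_def)
  then have "det S * det T = 1" using det_mult[OF carr] by simp
  moreover have "S *\<^sub>v unit_vec r q = 0\<^sub>v r"
    using q by (intro eq_vecI) (auto simp: S_def scalar_prod_def intro!: sum.neutral)
  then have "det S = 0"
    using det_0_iff_vec_prod_zero[OF carr(1)] q by (metis unit_vec_carrier unit_vec_nonzero)
  ultimately show False by simp
qed

text \<open>
  The homogeneous generators \<open>b\<^sub>j\<close> cannot be beaten by inhomogeneous ones. If \<open>a\<^sub>1, \<dots>, a\<^sub>q\<close> also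
  generate \<open>L\<close>, express the \<open>b\<^sub>j\<close> through the \<open>a\<^sub>i\<close> and back. By Nakayama the composition is the
  identity modulo \<open>\<mm>\<close>, which therefore factors through dimension \<open>q\<close>.
\<close>
lemma min_num_gens_eq:
  assumes min: "min_homog_gens n L r b"
  shows "min_num_gens (mpoly_ring n) L = r"
proof (rule antisym)
  have h: "homog_gens n L r b" using min by (simp add: min_homog_gens_def)
  note sub = homog_gens_subset[OF h]
  define Q where "Q m \<longleftrightarrow> (\<exists>A \<subseteq> carrier (mpoly_ring n). finite A \<and> card A = m \<and> Idl\<^bsub>mpoly_ring n\<^esub> A = L)" for m
  have mu: "min_num_gens (mpoly_ring n) L = (LEAST m. Q m)"
    by (simp add: min_num_gens_def Q_def)
  have Q: "Q (card (b ` {..<r}))"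
    unfolding Q_def mpoly_ring_eq using sub h mp.Idl_eq_gen[OF sub]
    by (intro exI[of _ "b ` {..<r}"]) (auto simp: homog_gens_def)
  then have "(LEAST m. Q m) \<le> card (b ` {..<r})" by (rule Least_le)
  also have "\<dots> \<le> r" using card_image_le[of "{..<r}" b] by simp
  finally show "min_num_gens (mpoly_ring n) L \<le> r" by (simp add: mu)
  have "Q (LEAST m. Q m)" using Q by (rule LeastI)
  then obtain A where A: "A \<subseteq> mpolys n" "finite A" "card A = (LEAST m. Q m)" "Idl\<^bsub>mpoly_ring n\<^esub> A = L"
    unfolding Q_def by (auto simp: mpoly_ring_eq)
  then have AL: "gen (mpolys n) A = L" by (simp add: mpoly_ring_eq mp.Idl_eq_gen)
  obtain a where "bij_betw a {0..<card A} A" using ex_bij_betw_nat_finite[OF A(2)] by blast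
  then have aA: "a ` {..<card A} = A" by (simp add: bij_betw_def atLeast0LessThan)
  have "b j \<in> gen (mpolys n) (a ` {..<card A})" if "j < r" for j
    using that h mp.gen_self[of "b ` {..<r}" n] unfolding aA AL by (auto simp: homog_gens_def)
  then have "\<exists>c. (\<forall>i<card A. c i \<in> mpolys n) \<and> b j = (\<Sum>i<card A. c i * a i)" if "j < r" for j
    using that by (simp add: mp.gen_image_lessThan_iff)
  then obtain s where s: "\<And>j i. j < r \<Longrightarrow> i < card A \<Longrightarrow> s j i \<in> mpolys n"
    "\<And>j. j < r \<Longrightarrow> b j = (\<Sum>i<card A. s j i * a i)"
    by metis
  have "a i \<in> gen (mpolys n) (b ` {..<r})" if "i < card A" for i
    using that h mp.gen_self[of A n] aA unfolding AL by (auto simp: homog_gens_def)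
  then have "\<exists>c. (\<forall>l<r. c l \<in> mpolys n) \<and> a i = (\<Sum>l<r. c l * b l)" if "i < card A" for i
    using that by (simp add: mp.gen_image_lessThan_iff)
  then obtain t where t: "\<And>i l. i < card A \<Longrightarrow> l < r \<Longrightarrow> t i l \<in> mpolys n"
    "\<And>i. i < card A \<Longrightarrow> a i = (\<Sum>l<r. t i l * b l)"
    by metis
  have "(\<Sum>i<card A. const_coeff (s j i) * const_coeff (t i l)) = (if j = l then 1 else 0)"
    if j: "j < r" and l: "l < r" for j l
  proof -
    define u where "u l = (\<Sum>i<card A. s j i * t i l) - (if j = l then 1 else 0)" for l
    have "b j = (\<Sum>i<card A. s j i * (\<Sum>l<r. t i l * b l))"
      using s(2)[OF j] t(2) by simp
    also have "\<dots> = (\<Sum>l<r. (\<Sum>i<card A. s j i * t i l) * b l)"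
      unfolding sum_distrib_left sum_distrib_right
      by (subst sum.swap) (simp add: mult.assoc)
    finally have "(\<Sum>l<r. (\<Sum>i<card A. s j i * t i l) * b l) = b j" by simp
    moreover have "(\<Sum>l<r. (if j = l then 1 else 0) * b l) = b j"
      using j by (simp add: if_distrib[of "\<lambda>x. x * _"] sum.delta cong: if_cong)
    ultimately have "(\<Sum>l<r. u l * b l) = 0"
      by (simp add: u_def left_diff_distrib sum_subtractf)
    moreover have "u l \<in> mpolys n" if "l < r" for l
      unfolding u_def using s(1)[OF j] t(1) that
      by (intro mp.diff_mem mp.sum_mem mp.mult_mem) (auto simp: mp.zero_mem mp.one_mem)
    ultimately have "const_coeff (u l) = 0"
      using min_homog_gens_relation[OF min, of u l] l by blast
    then show ?thesis
      by (auto simp: u_def lookup_minus lookup_sum const_coeff_mult lookup_one split: if_splits)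
  qed
  then have "r \<le> card A" by (rule identity_factor_le)
  then show "r \<le> min_num_gens (mpoly_ring n) L" by (simp add: mu A(3))
qed

lemma min_homog_gens_const_relation:
  assumes min: "min_homog_gens n L r b"
    and "(\<Sum>j<r. const_mpoly (c j) * b j) \<in> max_ideal n \<cdot>\<^bsub>ring_on (mpolys n)\<^esub> L" and j: "j < r"
  shows "c j = 0"
proof -
  have h: "homog_gens n L r b" using min by (simp add: min_homog_gens_def)
  then obtain d where d: "\<forall>j<r. d j \<in> max_ideal n"
    "(\<Sum>j<r. const_mpoly (c j) * b j) = (\<Sum>j<r. d j * b j)"
    using assms(2) mp.ideal_prod_gen_iff[OF ideal_max_ideal homog_gens_subset[OF h]] by (auto simp: homog_gens_def)
  define s where "s j = const_mpoly (c j) - d j" for j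
  have "(\<Sum>j<r. s j * b j) = 0" by (simp add: s_def left_diff_distrib sum_subtractf d(2))
  then have "const_coeff (s j) = 0"
    using d(1) by (intro min_homog_gens_relation[OF min _ _ j]) (auto simp: s_def max_ideal_def intro: mp.diff_mem const_mpoly_mem)
  then show ?thesis using d(1) j by (simp add: s_def lookup_minus max_ideal_def)
qed

section \<open>The fiber ring\<close>

locale fiber = type_subring A for A :: "'a::comm_ring_1 set" +
  fixes M I :: "'a set"
  assumes M: "ideal M (ring_on A)" and I: "ideal I (ring_on A)"
begin

abbreviation "R \<equiv> ring_on A"
definition "Ipow k = ideal_power R I k"
abbreviation "J k \<equiv> M \<cdot>\<^bsub>R\<^esub> Ipow k"
abbreviation "FR \<equiv> fiber_ring R M I"

sublocale R: cring R
  by (rule cring_on)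

lemma Ipow_0: "Ipow 0 = A"
  by (simp add: Ipow_def nat_pow_def ideals_set_def)

lemma Ipow_Suc: "Ipow (Suc k) = Ipow k \<cdot>\<^bsub>R\<^esub> I"
  by (simp add: Ipow_def nat_pow_def ideals_set_def)

lemma ideal_Ipow: "ideal (Ipow k) R"
proof (induction k)
  case 0
  show ?case unfolding Ipow_0 by (auto simp: ideal_on_iff zero_mem add_mem mult_mem)
next
  case (Suc k)
  then show ?case unfolding Ipow_Suc by (rule R.ideal_prod_is_ideal[OF _ I])
qed

lemma ideal_J: "ideal (J k) R"
  by (rule R.ideal_prod_is_ideal[OF M ideal_Ipow])

lemmas Ipow = ideal_onD[OF ideal_Ipow]
lemmas J = ideal_onD[OF ideal_J]

lemma Ipow_mult_I: "x \<in> Ipow k \<Longrightarrow> y \<in> I \<Longrightarrow> x * y \<in> Ipow (Suc k)"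
  unfolding Ipow_Suc using ideal_prod.prod[of x "Ipow k" y I R] by simp

lemma Ipow_1: "Ipow (Suc 0) = I"
  unfolding Ipow_Suc Ipow_0 using R.ideal_prod_one[OF I]
    R.ideal_prod_commute[OF I R.oneideal] by simp

lemma Ipow_mult: "x \<in> Ipow i \<Longrightarrow> y \<in> Ipow j \<Longrightarrow> x * y \<in> Ipow (i + j)"
proof (induction j arbitrary: y)
  case 0
  then show ?case using Ipow(4)[of y x i] by (simp add: Ipow_0 mult.commute)
next
  case (Suc j)
  from Suc.prems(2) have "y \<in> Ipow j \<cdot>\<^bsub>R\<^esub> I" by (simp only: Ipow_Suc)
  then show ?case
  proof (induction rule: ideal_prod.induct)
    case (prod u v)
    then have "x * u * v \<in> Ipow (Suc (i + j))"
      using Suc.IH[OF Suc.prems(1)] Ipow_mult_I by blast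
    then show ?case by (simp add: mult.assoc)
  next
    case (sum s t)
    then show ?case using Ipow(3)[of "x * s" "i + Suc j" "x * t"] by (simp add: distrib_left)
  qed
qed

lemma J_subset_Ipow: "x \<in> J k \<Longrightarrow> x \<in> Ipow k"
  using R.ideal_prod_inter[OF M ideal_Ipow] by blast

lemma M_mult: "x \<in> M \<Longrightarrow> y \<in> Ipow k \<Longrightarrow> x * y \<in> J k"
  using ideal_prod.prod[of x M y "Ipow k" R] by simp

lemma J_mult: "x \<in> Ipow i \<Longrightarrow> y \<in> J j \<Longrightarrow> x * y \<in> J (i + j)"
proof -
  assume x: "x \<in> Ipow i" and "y \<in> J j"
  from this(2) show ?thesis
  proof (induction rule: ideal_prod.induct)
    case (prod u v)
    then have "u * (x * v) \<in> J (i + j)" using Ipow_mult[OF x] by (intro M_mult) auto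
    then show ?case by (simp add: mult.left_commute)
  next
    case (sum s t)
    then show ?case using J(3) by (simp add: distrib_left)
  qed
qed

abbreviation coset :: "nat \<Rightarrow> 'a \<Rightarrow> 'a set"
  where "coset k a \<equiv> J k +>\<^bsub>R\<^esub> a"

lemma coset_def': "coset k a = {h + a |h. h \<in> J k}"
  by (auto simp: a_r_coset_def')

lemma coset_0: "coset k 0 = J k"
  by (simp add: coset_def')

lemma coset_eq_iff: "coset k a = coset k b \<longleftrightarrow> a - b \<in> J k"
proof
  assume "coset k a = coset k b"
  moreover have "0 + a \<in> coset k a" unfolding coset_def' using J(2) by blast
  ultimately show "a - b \<in> J k" by (auto simp: coset_def')
next
  assume ab: "a - b \<in> J k"
  have "\<exists>h'. h + a = h' + b \<and> h' \<in> J k" if "h \<in> J k" for h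
    using J(3)[OF that ab] by (intro exI[of _ "h + (a - b)"]) auto
  moreover have "\<exists>h'. h + b = h' + a \<and> h' \<in> J k" if "h \<in> J k" for h
    using J(5)[OF that ab] by (intro exI[of _ "h - (a - b)"]) auto
  ultimately show "coset k a = coset k b" by (auto simp: coset_def')
qed

lemma coset_eq_J_iff: "coset k a = J k \<longleftrightarrow> a \<in> J k"
  using coset_eq_iff[of k a 0] by (simp add: coset_0)

lemma coset_add: "a \<in> A \<Longrightarrow> b \<in> A \<Longrightarrow> coset k a \<oplus>\<^bsub>R Quot J k\<^esub> coset k b = coset k (a + b)"
proof -
  interpret Jk: ideal "J k" R by (rule ideal_J)
  show "a \<in> A \<Longrightarrow> b \<in> A \<Longrightarrow> ?thesis"
    using Jk.a_rcos_sum[of a b] by (simp add: FactRing_def)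
qed

lemma coset_mult:
  assumes "a \<in> Ipow i" "b \<in> Ipow j"
  shows "rcoset_mult R (J (i + j)) (coset i a) (coset j b) = coset (i + j) (a * b)"
proof -
  have eq: "coset (i + j) (x * y) = coset (i + j) (a * b)" if xy: "x \<in> coset i a" "y \<in> coset j b" for x y
  proof -
    obtain g h where g: "g \<in> J i" "x = g + a" and h: "h \<in> J j" "y = h + b"
      using xy by (auto simp: coset_def')
    have "(g + a) * h \<in> J (i + j)"
      using J_mult[of "g + a" i h j] Ipow(3) J_subset_Ipow g h assms by blast
    moreover have "b * g \<in> J (j + i)" using J_mult[OF assms(2) g(1)] .
    ultimately have "(g + a) * h + b * g \<in> J (i + j)" using J(3) by (simp add: add.commute)
    moreover have "x * y - a * b = (g + a) * h + b * g" by (simp add: g h algebra_simps)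
    ultimately show ?thesis by (simp add: coset_eq_iff)
  qed
  have "0 + a \<in> coset i a" "0 + b \<in> coset j b" unfolding coset_def' using J(2) by blast+
  then have ne: "coset i a \<noteq> {}" "coset j b \<noteq> {}" by blast+
  have "rcoset_mult R (J (i + j)) (coset i a) (coset j b) =
      (\<Union>x\<in>coset i a. \<Union>y\<in>coset j b. coset (i + j) (a * b))"
    unfolding rcoset_mult_def ring_on_simps by (intro SUP_cong refl eq)
  also have "\<dots> = coset (i + j) (a * b)" using ne by (simp only: UN_constant if_False)
  finally show ?thesis .
qed

lemma coset_finsum:
  assumes "finite F" "\<And>i. i \<in> F \<Longrightarrow> g i \<in> A"
  shows "(\<Oplus>\<^bsub>R Quot J k\<^esub>i\<in>F. coset k (g i)) = coset k (\<Sum>i\<in>F. g i)"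
proof -
  interpret Q: ring "R Quot J k" by (rule ideal.quotient_is_ring[OF ideal_J])
  have carr: "coset k a \<in> carrier (R Quot J k)" if "a \<in> A" for a
    using that by (auto simp: FactRing_def A_RCOSETS_def')
  show ?thesis
    using assms
  proof (induction F rule: finite_induct)
    case empty
    show ?case by (simp add: coset_0) (simp add: FactRing_def)
  next
    case (insert i F)
    then show ?case
      using carr coset_add[of "g i" "sum g F"] by (simp add: Pi_def sum_mem)
  qed
qed

lemmas fiber_ring_eq = fiber_ring_def[of R M I, unfolded Let_def, folded Ipow_def]

text \<open>
  The Rees algebra \<open>\<Oplus>\<^sub>k I\<^sup>k t\<^sup>k\<close>. The fiber ring is its image under \<open>fiber_of\<close>, from which it
  inherits the ring laws.
\<close>
definition rees :: "'a poly set"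
  where "rees = {p. \<forall>k. coeff p k \<in> Ipow k}"

definition fiber_of :: "'a poly \<Rightarrow> nat \<Rightarrow> 'a set"
  where "fiber_of p k = coset k (coeff p k)"

lemma reesD: "p \<in> rees \<Longrightarrow> coeff p k \<in> Ipow k"
  by (simp add: rees_def)

lemma rees_mult: "p \<in> rees \<Longrightarrow> q \<in> rees \<Longrightarrow> p * q \<in> rees"
proof -
  assume p: "p \<in> rees" and q: "q \<in> rees"
  have "coeff p i * coeff q (k - i) \<in> Ipow k" if "i \<le> k" for i k
    using Ipow_mult[OF reesD[OF p] reesD[OF q], of i "k - i"] that by simp
  then show ?thesis
    by (auto simp: rees_def coeff_mult intro!: Ipow(6))
qed

lemma rees_add: "p \<in> rees \<Longrightarrow> q \<in> rees \<Longrightarrow> p + q \<in> rees"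
  using Ipow(3) by (auto simp: rees_def)

lemma rees_zero: "0 \<in> rees"
  using Ipow(2) by (auto simp: rees_def)

lemma rees_uminus: "p \<in> rees \<Longrightarrow> - p \<in> rees"
  using Ipow(5)[OF Ipow(2)] by (auto simp: rees_def)

lemma rees_one: "1 \<in> rees"
  using Ipow(2) by (auto simp: rees_def coeff_1 Ipow_0 one_mem)

lemma rees_monom: "u \<in> Ipow k \<Longrightarrow> monom u k \<in> rees"
  using Ipow(2) by (auto simp: rees_def)

lemma fiber_ring_carrier: "carrier FR = fiber_of ` rees"
proof
  show "fiber_of ` rees \<subseteq> carrier FR"
  proof safe
    fix p assume p: "p \<in> rees"
    have "{k. fiber_of p k \<noteq> J k} \<subseteq> {..degree p}"
      using coeff_eq_0[of p] by (force simp: fiber_of_def coset_0 not_le)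
    then have "finite {k. fiber_of p k \<noteq> J k}" by (rule finite_subset) simp
    moreover have "\<exists>a \<in> Ipow k. fiber_of p k = coset k a" for k
      using reesD[OF p] by (auto simp: fiber_of_def)
    ultimately show "fiber_of p \<in> carrier FR" by (simp add: fiber_ring_eq)
  qed
  show "carrier FR \<subseteq> fiber_of ` rees"
  proof
    fix f assume "f \<in> carrier FR"
    then have "\<forall>k. \<exists>a. a \<in> Ipow k \<and> f k = coset k a" and fin: "finite {k. f k \<noteq> J k}"
      by (auto simp: fiber_ring_eq)
    from choice[OF this(1)] obtain a where a: "\<And>k. a k \<in> Ipow k" "\<And>k. f k = coset k (a k)"
      by blast
    define p where "p = (\<Sum>k\<in>{k. f k \<noteq> J k}. monom (a k) k)"
    have coeff: "coeff p k = (if f k \<noteq> J k then a k else 0)" for k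
      using fin by (simp add: p_def coeff_sum)
    then have "p \<in> rees" using a Ipow(2) by (auto simp: rees_def)
    moreover have "f = fiber_of p"
      using a coset_0 by (auto simp: fun_eq_iff fiber_of_def coeff)
    ultimately show "f \<in> fiber_of ` rees" by blast
  qed
qed

lemma fiber_ring_zero: "\<zero>\<^bsub>FR\<^esub> = fiber_of 0"
  by (simp add: fiber_ring_eq fiber_of_def coset_0 fun_eq_iff)

lemma fiber_ring_one: "\<one>\<^bsub>FR\<^esub> = fiber_of 1"
  by (simp add: fiber_ring_eq fiber_of_def coset_0 fun_eq_iff coeff_1)

lemma fiber_ring_add: "p \<in> rees \<Longrightarrow> q \<in> rees \<Longrightarrow> fiber_of p \<oplus>\<^bsub>FR\<^esub> fiber_of q = fiber_of (p + q)"
  using coset_add Ipow(1)[OF reesD]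
  by (simp add: fiber_ring_eq fiber_of_def fun_eq_iff)

lemma fiber_ring_mult:
  assumes p: "p \<in> rees" and q: "q \<in> rees"
  shows "fiber_of p \<otimes>\<^bsub>FR\<^esub> fiber_of q = fiber_of (p * q)"
proof
  fix k
  have mem: "coeff p i * coeff q (k - i) \<in> A" for i
    using mult_mem Ipow(1)[OF reesD] p q by blast
  have "rcoset_mult R (J k) (fiber_of p i) (fiber_of q (k - i)) = coset k (coeff p i * coeff q (k - i))"
    if "i \<le> k" for i
    using coset_mult[OF reesD[OF p] reesD[OF q], of i "k - i"] that by (simp add: fiber_of_def)
  note * = this
  have "(fiber_of p \<otimes>\<^bsub>FR\<^esub> fiber_of q) k =
      (\<Oplus>\<^bsub>R Quot J k\<^esub>i\<in>{..k}. coset k (coeff p i * coeff q (k - i)))"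
  proof -
    interpret Q: ring "R Quot J k" by (rule ideal.quotient_is_ring[OF ideal_J])
    have carr: "coset k a \<in> carrier (R Quot J k)" if "a \<in> A" for a
      using that by (auto simp: FactRing_def A_RCOSETS_def')
    have "(\<Oplus>\<^bsub>R Quot J k\<^esub>i\<in>{..k}. rcoset_mult R (J k) (fiber_of p i) (fiber_of q (k - i))) =
      (\<Oplus>\<^bsub>R Quot J k\<^esub>i\<in>{..k}. coset k (coeff p i * coeff q (k - i)))"
      using * carr mem by (intro Q.finsum_cong') auto
    then show ?thesis by (simp add: fiber_ring_eq)
  qed
  then show "(fiber_of p \<otimes>\<^bsub>FR\<^esub> fiber_of q) k = fiber_of (p * q) k"
    using coset_finsum[of "{..k}" "\<lambda>i. coeff p i * coeff q (k - i)" k] mem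
    by (simp add: fiber_of_def coeff_mult)
qed

lemma ring_fiber_ring: "ring FR"
proof (rule ringI)
  note ops = fiber_ring_zero fiber_ring_one fiber_ring_add fiber_ring_mult
    rees_mult rees_add rees_zero rees_one
  have rep: "(\<And>p. p \<in> rees \<Longrightarrow> x = fiber_of p \<Longrightarrow> thesis) \<Longrightarrow> thesis" if "x \<in> carrier FR" for x thesis
    using that unfolding fiber_ring_carrier by blast
  have mem: "fiber_of p \<in> carrier FR" if "p \<in> rees" for p
    using that unfolding fiber_ring_carrier by blast
  show "abelian_group FR"
  proof (rule abelian_groupI)
    fix x assume "x \<in> carrier FR"
    then obtain p where p: "p \<in> rees" "x = fiber_of p" by (rule rep)
    have "fiber_of (- p) \<oplus>\<^bsub>FR\<^esub> x = \<zero>\<^bsub>FR\<^esub>"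
      using p by (simp add: fiber_ring_add fiber_ring_zero rees_uminus)
    then show "\<exists>y\<in>carrier FR. y \<oplus>\<^bsub>FR\<^esub> x = \<zero>\<^bsub>FR\<^esub>"
      using mem[OF rees_uminus[OF p(1)]] by blast
  qed (erule rep | simp add: ops mem ac_simps)+
  show "Group.monoid FR"
    by (rule monoidI) (erule rep | simp add: ops mem ac_simps)+
  show "(x \<oplus>\<^bsub>FR\<^esub> y) \<otimes>\<^bsub>FR\<^esub> z = x \<otimes>\<^bsub>FR\<^esub> z \<oplus>\<^bsub>FR\<^esub> y \<otimes>\<^bsub>FR\<^esub> z"
    if "x \<in> carrier FR" "y \<in> carrier FR" "z \<in> carrier FR" for x y z
    using that by (elim rep) (simp add: ops distrib_right)
  show "z \<otimes>\<^bsub>FR\<^esub> (x \<oplus>\<^bsub>FR\<^esub> y) = z \<otimes>\<^bsub>FR\<^esub> x \<oplus>\<^bsub>FR\<^esub> z \<otimes>\<^bsub>FR\<^esub> y"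
    if "x \<in> carrier FR" "y \<in> carrier FR" "z \<in> carrier FR" for x y z
    using that by (elim rep) (simp add: ops distrib_left)
qed

text \<open>
  The first element of a regular sequence is a nonzerodivisor because the ideal generated by the
  empty set is zero. This needs that the fiber ring is a ring: otherwise it would have no ideals, and
  the intersection of all ideals would be the whole type.
\<close>
lemma depth_pos_nonzerodivisor:
  assumes "depth FR (fiber_ring_plus R M I) > 0"
  shows "\<exists>x \<in> fiber_ring_plus R M I. \<forall>r \<in> carrier FR. x \<otimes>\<^bsub>FR\<^esub> r = \<zero>\<^bsub>FR\<^esub> \<longrightarrow> r = \<zero>\<^bsub>FR\<^esub>"
proof -
  interpret FR: ring FR by (rule ring_fiber_ring)
  obtain xs where xs: "regular_sequence FR xs" "set xs \<subseteq> fiber_ring_plus R M I" "enat (length xs) > 0"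
    using assms unfolding depth_def less_SUP_iff by blast
  then have len: "length xs > 0" by (simp add: zero_enat_def)
  have zero: "Idl\<^bsub>FR\<^esub> {} = {\<zero>\<^bsub>FR\<^esub>}"
  proof
    show "Idl\<^bsub>FR\<^esub> {} \<subseteq> {\<zero>\<^bsub>FR\<^esub>}"
      by (rule FR.genideal_minimal[OF FR.zeroideal]) simp
    show "{\<zero>\<^bsub>FR\<^esub>} \<subseteq> Idl\<^bsub>FR\<^esub> {}"
      using additive_subgroup.zero_closed[OF ideal.axioms(1)[OF FR.genideal_ideal[of "{}"]]] by simp
  qed
  have "\<forall>r \<in> carrier FR. xs ! 0 \<otimes>\<^bsub>FR\<^esub> r \<in> Idl\<^bsub>FR\<^esub> {} \<longrightarrow> r \<in> Idl\<^bsub>FR\<^esub> {}"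
    using xs(1) len unfolding regular_sequence_def by fastforce
  then show ?thesis
    using xs(2) len unfolding zero by (intro bexI[of _ "xs ! 0"]) auto
qed

text \<open>
  An element of \<open>F\<^sub>k\<close> that is annihilated by \<open>F\<^sub>1\<close> is annihilated by all of \<open>F\<^sub>+\<close>, hence by a
  nonzerodivisor.
\<close>
lemma depth_pos_socle:
  assumes depth: "depth FR (fiber_ring_plus R M I) > 0"
    and u: "u \<in> Ipow k" and ann: "\<And>a. a \<in> I \<Longrightarrow> a * u \<in> J (Suc k)"
  shows "u \<in> J k"
proof -
  obtain x where x: "x \<in> fiber_ring_plus R M I"
    "\<And>r. r \<in> carrier FR \<Longrightarrow> x \<otimes>\<^bsub>FR\<^esub> r = \<zero>\<^bsub>FR\<^esub> \<Longrightarrow> r = \<zero>\<^bsub>FR\<^esub>"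
    using depth_pos_nonzerodivisor[OF depth] by blast
  then obtain p where p: "p \<in> rees" "x = fiber_of p"
    by (auto simp: fiber_ring_plus_def fiber_ring_carrier)
  have p0: "coeff p 0 \<in> J 0"
    using x(1) p by (simp add: fiber_ring_plus_def fiber_ring_zero fiber_of_def coset_0 coset_eq_J_iff)
  have pu: "coeff p i * u \<in> J (i + k)" for i
  proof (cases i)
    case 0
    have "u * coeff p 0 \<in> J (k + 0)" by (rule J_mult[OF u p0])
    then show ?thesis using 0 by (simp add: mult.commute)
  next
    case (Suc i')
    have "coeff p i \<in> Ipow i' \<cdot>\<^bsub>R\<^esub> I" using reesD[OF p(1), of i] by (simp only: Suc Ipow_Suc)
    then show ?thesis
    proof (induction rule: ideal_prod.induct)
      case (prod v w)
      then have "v * (w * u) \<in> J (i' + Suc k)" using ann by (intro J_mult)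
      then show ?case by (simp add: Suc mult.assoc)
    next
      case (sum s t)
      then show ?case using J(3) by (simp add: distrib_right)
    qed
  qed
  have "fiber_of (p * monom u k) = fiber_of 0"
  proof
    fix l
    have "coeff (p * monom u k) l \<in> J l"
      using pu[of "l - k"] J(2) by (cases "l < k") (simp_all add: mult.commute[of p] coeff_monom_mult mult.commute[of u])
    then show "fiber_of (p * monom u k) l = fiber_of 0 l"
      by (simp add: fiber_of_def coset_0 coset_eq_J_iff)
  qed
  then have "x \<otimes>\<^bsub>FR\<^esub> fiber_of (monom u k) = \<zero>\<^bsub>FR\<^esub>"
    using fiber_ring_mult[OF p(1) rees_monom[OF u]] by (simp add: p(2) fiber_ring_zero)
  then have "fiber_of (monom u k) = fiber_of 0"
    using x(2)[of "fiber_of (monom u k)"] rees_monom[OF u]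
    by (simp add: fiber_ring_carrier fiber_ring_zero)
  then have "fiber_of (monom u k) k = fiber_of 0 k" by (rule fun_cong)
  then have "coset k u = J k" by (simp add: fiber_of_def coset_0)
  then show ?thesis by (simp add: coset_eq_J_iff)
qed

end

section \<open>Height in factorial domains\<close>

context type_subdomain
begin

lemma prime_in_primeideal:
  assumes Q: "primeideal Q (ring_on A)" and x: "x \<in> prime_prods A" "x \<in> Q"
  shows "\<exists>p \<in> Q. prime_on A p"
  using x
proof (induction rule: prime_prods.induct)
  interpret Q: primeideal Q "ring_on A" by (rule Q)
  note QD = ideal_onD[OF Q.is_ideal]
  case (unit u)
  then obtain v where v: "v \<in> A" "u * v = 1" by (auto simp: unit_on_def)
  then have "1 \<in> Q" using QD(4)[of v u] unit by (simp add: mult.commute)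
  then have "A \<subseteq> Q" using QD(4)[of _ 1] by auto
  then show ?case using Q.I_notcarr QD(1) by auto
next
  interpret Q: primeideal Q "ring_on A" by (rule Q)
  case (mult p x)
  then show ?case
    using Q.I_prime[of p x] prime_onD(1)[OF mult(1)] prime_prods_carrier[OF mult(2)] by auto
qed

lemma primeideal_multiples:
  assumes p: "prime_on A p"
  shows "primeideal {x \<in> A. dvd_on A p x} (ring_on A)"
proof (rule primeidealI)
  note pD = prime_onD[OF p]
  show "ideal {x \<in> A. dvd_on A p x} (ring_on A)"
    unfolding ideal_on_iff using dvd_zero zero_mem dvd_add add_mem dvd_mult_left mult_mem by auto
  have "1 \<notin> {x \<in> A. dvd_on A p x}"
    using dvd_unit[OF _ pD(1) unit_one] pD(3) by blast
  then show "carrier (ring_on A) \<noteq> {x \<in> A. dvd_on A p x}" using one_mem by auto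
  show "a \<in> {x \<in> A. dvd_on A p x} \<or> b \<in> {x \<in> A. dvd_on A p x}"
    if "a \<in> carrier (ring_on A)" "b \<in> carrier (ring_on A)"
      "a \<otimes>\<^bsub>ring_on A\<^esub> b \<in> {x \<in> A. dvd_on A p x}" for a b
    using that pD(4)[of a b] by simp
qed (rule cring_on)

lemma height_le_prime_height:
  "primeideal P R \<Longrightarrow> I \<subseteq> P \<Longrightarrow> height R I \<le> prime_height R P"
  unfolding height_def by (rule INF_lower) simp

text \<open>
  In a factorial domain every nonzero prime ideal contains a prime element. If the prime ideal lies
  in \<open>(p)\<close>, this element is associated to \<open>p\<close>, so the prime ideal is \<open>(p)\<close>.
  Hence \<open>(p)\<close> has height at most 1.
\<close>
lemma height_le_1_if_prime_dvd:
  assumes fact: "factorial_on A" and p: "prime_on A p"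
    and I: "I \<subseteq> A" "\<And>x. x \<in> I \<Longrightarrow> dvd_on A p x"
  shows "height (ring_on A) I \<le> 1"
proof -
  define P where "P = {x \<in> A. dvd_on A p x}"
  have P: "primeideal P (ring_on A)" unfolding P_def by (rule primeideal_multiples[OF p])
  have "r \<le> 1" if Q: "\<forall>i\<le>r. primeideal (Q i) (ring_on A)" "\<forall>i<r. Q i \<subset> Q (Suc i)" "Q r = P" for r and Q :: "nat \<Rightarrow> 'a set"
  proof (rule ccontr)
    assume "\<not> r \<le> 1"
    then obtain m where m: "r = Suc (Suc m)" by (metis One_nat_def Suc_le_mono le0 not0_implies_Suc old.nat.exhaust)
    have prime: "primeideal (Q m) (ring_on A)" "primeideal (Q (Suc m)) (ring_on A)" using Q(1) m by auto
    have chain: "Q m \<subset> Q (Suc m)" "Q (Suc m) \<subset> P" using Q(2,3) m by auto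
    note D0 = ideal_onD[OF primeideal.axioms(1)[OF prime(1)]]
    note D1 = ideal_onD[OF primeideal.axioms(1)[OF prime(2)]]
    obtain g where "g \<in> Q (Suc m)" "g \<noteq> 0" using chain(1) D0(2) by blast
    then have "g \<in> prime_prods A" using fact D1(1) by (auto simp: factorial_on_def)
    then obtain q where q: "q \<in> Q (Suc m)" "prime_on A q"
      using prime_in_primeideal[OF prime(2)] \<open>g \<in> Q (Suc m)\<close> by blast
    then have "dvd_on A p q" using chain(2) by (auto simp: P_def)
    then have "dvd_on A q p" using prime_dvd_prime[OF p q(2)] by blast
    then have qx: "dvd_on A q x" if "x \<in> P" for x using that dvd_trans by (auto simp: P_def)
    have "x \<in> Q (Suc m)" if x: "x \<in> P" for x
    proof -
      obtain c where "c \<in> A" "x = q * c" using qx[OF x] by (auto simp: dvd_on_def)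
      then show ?thesis using D1(4)[of c q] q(1) by (simp add: mult.commute)
    qed
    then show False using chain(2) by blast
  qed
  then have "prime_height (ring_on A) P \<le> 1"
    unfolding prime_height_def by (intro SUP_least) (auto simp: one_enat_def)
  moreover have "I \<subseteq> P" using I by (auto simp: P_def)
  ultimately show ?thesis using height_le_prime_height[OF P] order_trans by blast
qed

lemma height_zero: "height (ring_on A) {0} = 0"
proof -
  have P: "primeideal {0} (ring_on A)"
  proof (rule primeidealI)
    show "ideal {0} (ring_on A)" by (simp add: ideal_on_iff zero_mem)
    show "carrier (ring_on A) \<noteq> {0}" using one_mem by auto
  qed (auto intro: cring_on)
  have "r = 0" if Q: "\<forall>i\<le>r. primeideal (Q i) (ring_on A)" "\<forall>i<r. Q i \<subset> Q (Suc i)" "Q r = {0}" for r and Q :: "nat \<Rightarrow> 'a set"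
  proof (rule ccontr)
    assume "r \<noteq> 0"
    then obtain m where m: "r = Suc m" using not0_implies_Suc by blast
    then have "Q m \<subset> {0}" "primeideal (Q m) (ring_on A)" using Q by auto
    then show False using ideal_onD(2)[OF primeideal.axioms(1)] by blast
  qed
  then have "prime_height (ring_on A) {0} \<le> 0"
    unfolding prime_height_def by (intro SUP_least) (auto simp: zero_enat_def)
  then show ?thesis using height_le_prime_height[OF P, of "{0}"] by simp
qed

end

section \<open>A generic linear form is a nonzerodivisor\<close>

context fiber
begin

text \<open>
  McCoy's argument. Let \<open>w\<close> be annihilated by \<open>f = \<Sum>\<^sub>i x\<^sub>i t\<^sup>i\<close> in \<open>F[t]\<close> and let \<open>N\<close> be its degree
  there. Going down from the largest \<open>j\<close>, suppose that \<open>x\<^sub>i w = 0\<close> for all \<open>i > j\<close>. The coefficient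
  of degree \<open>N + j\<close> of \<open>f w\<close> is then \<open>x\<^sub>j w\<^sub>N\<close>, so \<open>x\<^sub>j w\<close> has smaller degree than \<open>w\<close>. It is also
  annihilated by \<open>f\<close>, and so it is zero by induction. Thus all \<open>x\<^sub>j\<close> annihilate \<open>w\<close>, and the
  coefficients of \<open>w\<close> are zero by the hypothesis on socles. As \<open>x\<^sub>j w\<close> has coefficients in
  \<open>F\<^sub>k\<^sub>+\<^sub>1\<close>, the induction runs over all \<open>k\<close> at once.
\<close>
lemma mccoy:
  assumes gens: "I = gen A (x ` {..<q})"
    and socle: "\<And>k u. u \<in> Ipow k \<Longrightarrow> (\<And>a. a \<in> I \<Longrightarrow> a * u \<in> J (Suc k)) \<Longrightarrow> u \<in> J k"
    and w: "\<And>i. coeff w i \<in> Ipow k"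
    and fw: "\<And>i. coeff ((\<Sum>i<q. monom (x i) i) * w) i \<in> J (Suc k)"
  shows "coeff w i \<in> J k"
proof -
  define f where "f = (\<Sum>i<q. monom (x i) i)"
  have f: "coeff f i = (if i < q then x i else 0)" for i
    by (simp add: f_def coeff_sum)
  have xI: "x i \<in> I" if "i < q" for i
    using that gen_self[of "x ` {..<q}"] gens by auto
  have xIp: "x i \<in> Ipow (Suc 0)" if "i < q" for i
    using xI[OF that] by (simp only: Ipow_1)
  have main: "\<forall>i. coeff w i \<in> J k"
    if "\<And>i. coeff w i \<in> Ipow k" "\<And>i. coeff (f * w) i \<in> J (Suc k)" "\<And>i. N \<le> i \<Longrightarrow> coeff w i \<in> J k" for N w k
    using that
  proof (induction N arbitrary: w k)
    case (Suc N)
    have xw: "\<forall>i. x j * coeff w i \<in> J (Suc k)" if "j < q" for j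
      using that
    proof (induction "q - j" arbitrary: j rule: less_induct)
      case (less j)
      have high: "x j * coeff w i \<in> J (Suc k)" if "N < i" for i
        using J_mult[OF xIp[OF less(2)] Suc.prems(3)[of i]] that by simp
      have "(\<Sum>i\<in>{..N + j} - {j}. coeff f i * coeff w (N + j - i)) \<in> J (Suc k)"
      proof (rule J(6))
        fix i assume i: "i \<in> {..N + j} - {j}"
        show "coeff f i * coeff w (N + j - i) \<in> J (Suc k)"
        proof (cases "i < j")
          case True
          then show ?thesis
            using J_mult[OF xIp[of i] Suc.prems(3)[of "N + j - i"]] less(2) by (simp add: f)
        next
          case False
          then show ?thesis
            using less(1)[of i] i J(2) by (auto simp: f)
        qed
      qed
      moreover have "coeff (f * w) (N + j) = x j * coeff w N +
          (\<Sum>i\<in>{..N + j} - {j}. coeff f i * coeff w (N + j - i))"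
        using less(2) by (simp add: coeff_mult sum.remove[of "{..N + j}" j] f)
      ultimately have "x j * coeff w N \<in> J (Suc k)"
        using J(5)[OF Suc.prems(2)[of "N + j"], of "\<Sum>i\<in>{..N + j} - {j}. coeff f i * coeff w (N + j - i)"]
        by simp
      then have high': "coeff (smult (x j) w) i \<in> J (Suc k)" if "N \<le> i" for i
        using high[of i] that by (cases "i = N") auto
      have "coeff (smult (x j) w) i \<in> Ipow (Suc k)" for i
        using Ipow_mult[OF xIp[OF less(2)] Suc.prems(1)[of i]] by simp
      moreover have "coeff (f * smult (x j) w) i \<in> J (Suc (Suc k))" for i
        using J_mult[OF xIp[OF less(2)] Suc.prems(2)[of i]] by simp
      ultimately have "\<forall>i. coeff (smult (x j) w) i \<in> J (Suc k)"
        using Suc.IH high' by blast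
      then show ?case by simp
    qed
    show ?case
    proof
      fix i
      show "coeff w i \<in> J k"
      proof (rule socle[OF Suc.prems(1)])
        fix a assume "a \<in> I"
        then have "a \<in> gen A (x ` {..<q})" by (simp only: gens)
        then obtain c where c: "\<forall>j<q. c j \<in> A" "a = (\<Sum>j<q. c j * x j)"
          by (auto simp: gen_image_lessThan_iff)
        have "a * coeff w i = (\<Sum>j<q. c j * (x j * coeff w i))"
          by (simp add: c(2) sum_distrib_right mult.assoc)
        also have "\<dots> \<in> J (Suc k)"
        proof (rule J(6))
          show "c j * (x j * coeff w i) \<in> J (Suc k)" if "j \<in> {..<q}" for j
            using c(1) xw that J(4)[of "c j" "x j * coeff w i" "Suc k"] by simp
        qed
        finally show "a * coeff w i \<in> J (Suc k)" .
      qed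
    qed
  qed auto
  have "coeff w i \<in> J k" if "degree w < i" for i
    using coeff_eq_0[OF that] J(2) by simp
  then show ?thesis
    using main[of w k "Suc (degree w)"] w fw by (simp add: f_def Suc_le_eq)
qed

end

section \<open>Growth of the number of generators\<close>

lemma (in type_subring) det_mem:
  assumes "B \<in> carrier_mat r r" "\<And>i j. i < r \<Longrightarrow> j < r \<Longrightarrow> B $$ (i, j) \<in> A"
  shows "det B \<in> A"
  unfolding det_def'[OF assms(1)]
proof (intro sum_mem mult_mem prod_mem)
  fix p assume p: "p \<in> {p. p permutes {0..<r}}"
  show "signof p \<in> A" using one_mem uminus_mem by (simp add: sign_def)
  fix i assume i: "i \<in> {0..<r}"
  then have "p i < r" using p permutes_in_image[of p "{0..<r}" i] by auto
  then show "B $$ (i, p i) \<in> A" using assms(2) i by auto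
qed

lemma (in type_subring) adj_mat_mem:
  assumes B: "B \<in> carrier_mat r r" "\<And>i j. i < r \<Longrightarrow> j < r \<Longrightarrow> B $$ (i, j) \<in> A"
    and ij: "i < r" "j < r"
  shows "adj_mat B $$ (i, j) \<in> A"
proof -
  have "det (mat_delete B j i) \<in> A"
  proof (rule det_mem)
    show "mat_delete B j i \<in> carrier_mat (r - 1) (r - 1)"
      using B(1) by (rule mat_delete_carrier)
    show "mat_delete B j i $$ (i', j') \<in> A" if "i' < r - 1" "j' < r - 1" for i' j'
      using that B by (auto simp: mat_delete_def)
  qed
  then show ?thesis
    using B(1) ij by (auto simp: adj_mat_def cofactor_def intro!: mult_mem power_mem uminus_mem one_mem)
qed

definition residue_poly :: "'k::field mpoly poly \<Rightarrow> 'k poly"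
  where "residue_poly p = map_poly const_coeff p"

lemma coeff_residue_poly: "coeff (residue_poly p) i = const_coeff (coeff p i)"
  by (simp add: residue_poly_def coeff_map_poly)

interpretation residue: comm_ring_hom "residue_poly :: 'k::field mpoly poly \<Rightarrow> 'k poly"
proof
  show "residue_poly (p * q) = residue_poly p * residue_poly q" for p q :: "'k mpoly poly"
    by (rule poly_eqI) (simp add: coeff_residue_poly coeff_mult lookup_sum const_coeff_mult)
qed (auto simp: poly_eq_iff coeff_residue_poly lookup_add coeff_1 lookup_one)

lemma residue_poly_eq_0_iff:
  "p \<in> polys (mpolys n) \<Longrightarrow> residue_poly p = 0 \<longleftrightarrow> (\<forall>i. coeff p i \<in> max_ideal n)"
  by (auto simp: poly_eq_iff coeff_residue_poly max_ideal_def polys_def)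

lemma homog_gens_Ipow:
  assumes h: "homog_gens n I q x"
  shows "\<exists>r b. homog_gens n (ideal_power (ring_on (mpolys n)) I k) r b"
proof -
  have "ideal I (ring_on (mpolys n))"
    using h mp.ideal_gen[OF homog_gens_subset[OF h]] by (simp add: homog_gens_def)
  then interpret F: fiber "mpolys n" "max_ideal n" I
    by (intro fiber.intro fiber_axioms.intro mpolys_subring ideal_max_ideal)
  have "\<exists>r b. homog_gens n (F.Ipow k) r b"
  proof (induction k)
    case 0
    have "F.Ipow 0 = gen (mpolys n) {1}"
    proof
      show "F.Ipow 0 \<subseteq> gen (mpolys n) {1}"
        using gen.step[of _ "mpolys n" 1 "{1}" 0] by (auto simp: F.Ipow_0 gen.zero)
      show "gen (mpolys n) {1} \<subseteq> F.Ipow 0"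
        using mp.gen_subset_carrier[of "{1}" n] mp.one_mem by (auto simp: F.Ipow_0)
    qed
    moreover have "homogeneous 0 (1 :: 'a mpoly)" by (simp add: homogeneous_iff mdeg_def)
    ultimately show ?case
      using homog_gens_of_finite[of "{1 :: 'a mpoly}" n] mp.one_mem by auto
  next
    case (Suc k)
    then obtain r b where b: "homog_gens n (F.Ipow k) r b" by blast
    define Z where "Z = {u * v |u v. u \<in> b ` {..<r} \<and> v \<in> x ` {..<q}}"
    have "Z = (\<lambda>(u, v). u * v) ` (b ` {..<r} \<times> x ` {..<q})" by (auto simp: Z_def)
    then have "finite Z" by simp
    moreover have "Z \<subseteq> mpolys n"
      unfolding Z_def using homog_gens_subset[OF b] homog_gens_subset[OF h] mp.mult_mem by blast
    moreover have "\<exists>d. homogeneous d z" if "z \<in> Z" for z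
      using that b h homogeneous_mult unfolding Z_def homog_gens_def by blast
    moreover have "F.Ipow (Suc k) = gen (mpolys n) Z"
      using mp.ideal_prod_gen[OF homog_gens_subset[OF b] homog_gens_subset[OF h]] b h
      by (simp add: F.Ipow_Suc homog_gens_def Z_def)
    ultimately show ?case using homog_gens_of_finite[of Z n] by simp
  qed
  then show ?thesis by (simp add: F.Ipow_def)
qed

text \<open>A homogeneous generator outside of the maximal ideal is a nonzero constant.\<close>
lemma homog_gens_proper:
  assumes h: "homog_gens n I q x" and proper: "I \<noteq> mpolys n" and i: "i < q"
  shows "x i \<in> max_ideal n"
proof (rule ccontr)
  assume "x i \<notin> max_ideal n"
  moreover have xi: "x i \<in> mpolys n" "\<exists>d. homogeneous d (x i)" using h i by (auto simp: homog_gens_def)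
  ultimately have c: "const_coeff (x i) \<noteq> 0" by (simp add: max_ideal_def)
  obtain d where d: "homogeneous d (x i)" using xi by blast
  moreover have "0 \<in> Poly_Mapping.keys (x i)" using c by (simp add: in_keys_iff)
  ultimately have "d = 0" by (auto simp: homogeneous_iff mdeg_eq_0_iff)
  then have "Poly_Mapping.keys (x i) \<subseteq> {0}" using d by (auto simp: homogeneous_iff mdeg_eq_0_iff)
  then have "x i = const_mpoly (const_coeff (x i))"
    by (intro poly_mapping_eqI) (auto simp: lookup_single when_def in_keys_iff)
  moreover have I: "ideal I (ring_on (mpolys n))" 
    using h mp.ideal_gen[OF homog_gens_subset[OF h]] by (simp add: homog_gens_def)
  moreover have "x i \<in> I" using h i mp.gen_self[of "x ` {..<q}" n] by (auto simp: homog_gens_def)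
  ultimately have "const_mpoly (inverse (const_coeff (x i))) * const_mpoly (const_coeff (x i)) \<in> I"
    using mp.ideal_onD(4)[OF I const_mpoly_mem] by metis
  then have "1 \<in> I" using c by (simp add: mult_single)
  then have "mpolys n \<subseteq> I" using mp.ideal_onD(4)[OF I, of _ 1] by auto
  then show False using proper mp.ideal_onD(1)[OF I] by blast
qed

lemma graded_ideal_homog_gens:
  assumes "graded_ideal n I"
  shows "\<exists>q x. homog_gens n I q x"
proof -
  obtain B where B: "B \<subseteq> mpolys n" "\<forall>b\<in>B. \<exists>d. homogeneous d b" "I = gen (mpolys n) B"
    using assms by (auto simp: graded_ideal_def mpoly_ring_eq mp.Idl_eq_gen)
  have I: "ideal I (ring_on (mpolys n))" unfolding B(3) by (rule mp.ideal_gen[OF B(1)])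
  obtain G where G: "G \<subseteq> I" "finite G" "I = gen (mpolys n) G"
    using noetherian_onD[OF noetherian_mpolys I] by metis
  obtain Y where Y: "Y \<subseteq> B" "finite Y" "G \<subseteq> gen (mpolys n) Y"
    using gen_finite_subset_set[of G "mpolys n" B] G B(3) by auto
  have "I = gen (mpolys n) Y"
    using mp.gen_subset[OF mp.ideal_gen[of Y n] Y(3)] gen_subset_mono[OF Y(1), of "mpolys n"] Y(1) B G(3)
    by auto
  moreover have "\<exists>d. homogeneous d y" if "y \<in> Y" for y using that Y(1) B(2) by blast
  then have "\<exists>q x. homog_gens n (gen (mpolys n) Y) q x"
    using homog_gens_of_finite[OF Y(2)] Y(1) B(1) by blast
  ultimately show ?thesis by simp
qed

interpretation mpp: type_subring "polys (mpolys n :: 'k::field mpoly set)" for n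
  by (rule mp.type_subring_polys)

lemma coeff_const_mult: "coeff (p * [:c:]) i = coeff p i * c"
  by (simp add: mult.commute[of p] mult.commute[of c])

text \<open>
  The comparison of \<open>\<mu>(I\<^sup>k) = r\<close> with \<open>\<mu>(I\<^sup>k\<^sup>+\<^sup>1) = s\<close> through the matrix of multiplication by the
  generic element \<open>f\<close> of \<open>I[t]\<close>.
\<close>
lemma num_gens_growth:
  fixes I :: "'k::field mpoly set" and n :: nat
  defines "R \<equiv> ring_on (mpolys n :: 'k mpoly set)"
  assumes x: "homog_gens n I q x" and proper: "I \<noteq> mpolys n"
    and depth: "depth (fiber_ring R (max_ideal n) I) (fiber_ring_plus R (max_ideal n) I) > 0"
    and b: "min_homog_gens n (ideal_power R I k) r b"
    and e: "min_homog_gens n (ideal_power R I (Suc k)) s e"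
    and sr: "s \<le> r"
  shows "s = r" and "height R I \<le> 1"
proof -
  let ?A = "mpolys n :: 'k mpoly set"
  have I: "ideal I (ring_on ?A)"
    using x mp.ideal_gen[OF homog_gens_subset[OF x]] by (simp add: homog_gens_def)
  have A0: "0 \<in> ?A" by (rule mp.zero_mem)
  interpret F: fiber ?A "max_ideal n" I
    by (intro fiber.intro fiber_axioms.intro mpolys_subring ideal_max_ideal I)
  have b: "min_homog_gens n (F.Ipow k) r b" and e: "min_homog_gens n (F.Ipow (Suc k)) s e"
    using b e by (simp_all only: F.Ipow_def R_def)
  have hb: "homog_gens n (F.Ipow k) r b" and he: "homog_gens n (F.Ipow (Suc k)) s e"
    using b e by (simp_all add: min_homog_gens_def)
  have genI: "I = gen ?A (x ` {..<q})" using x by (simp add: homog_gens_def)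
  have xI: "x i \<in> I" if "i < q" for i
    using that mp.gen_self[of "x ` {..<q}" n] by (auto simp: genI)
  have bk: "b j \<in> F.Ipow k" if "j < r" for j
    using that hb mp.gen_self[of "b ` {..<r}" n] by (auto simp: homog_gens_def)
  have ek: "e l \<in> F.Ipow (Suc k)" if "l < s" for l
    using that he mp.gen_self[of "e ` {..<s}" n] by (auto simp: homog_gens_def)
  define f where "f = (\<Sum>i<q. monom (x i) i)"
  have f: "coeff f i = (if i < q then x i else 0)" for i
    by (simp add: f_def coeff_sum)
  have fA: "f \<in> polys ?A"
    using mp.ideal_onD(1)[OF I] xI A0 by (auto simp: polys_def f)
  have f0: "residue_poly f = 0"
    using homog_gens_proper[OF x proper] mp.ideal_onD(2)[OF F.M]
    by (simp add: residue_poly_eq_0_iff[OF fA] f)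

  have ex: "\<exists>c. (\<forall>l<s. c l \<in> ?A) \<and> x i * b j = (\<Sum>l<s. c l * e l)" if "i < q" "j < r" for i j
  proof -
    have "b j * x i \<in> F.Ipow (Suc k)" using F.Ipow_mult_I[OF bk xI] that by blast
    then have "x i * b j \<in> gen ?A (e ` {..<s})" using he by (simp add: homog_gens_def mult.commute)
    then show ?thesis by (simp add: mp.gen_image_lessThan_iff)
  qed
  define m where "m i j = (SOME c. (\<forall>l<s. c l \<in> ?A) \<and> x i * b j = (\<Sum>l<s. c l * e l))" for i j
  have m: "l < s \<Longrightarrow> m i j l \<in> ?A" "x i * b j = (\<Sum>l<s. m i j l * e l)"
    if "i < q" "j < r" for i j l
    using someI_ex[OF ex[OF that]] unfolding m_def by blast+
  \<comment> \<open>zero entries for \<open>l \<ge> s\<close> make the matrix square\<close>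
  define N where "N j l = (if l < s then \<Sum>i<q. monom (m i j l) i else 0)" for j l
  define e' where "e' l = (if l < s then e l else 0)" for l
  have N: "coeff (N j l) i = (if l < s \<and> i < q then m i j l else 0)" for j l i
    by (simp add: N_def coeff_sum)
  have NA: "N j l \<in> polys ?A" if "j < r" for j l
    using m(1) that A0 by (simp add: polys_def N)
  have e'k: "e' l \<in> F.Ipow (Suc k)" for l
    using ek F.Ipow(2) by (simp add: e'_def)
  have fb: "f * [:b j:] = (\<Sum>l<r. N j l * [:e' l:])" if j: "j < r" for j
  proof (rule poly_eqI)
    fix i
    have "coeff (\<Sum>l<r. N j l * [:e' l:]) i = (\<Sum>l<r. coeff (N j l) i * e' l)"
      by (simp only: coeff_sum coeff_const_mult)
    also have "\<dots> = (\<Sum>l<s. coeff (N j l) i * e' l)"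
      using sr by (intro sum.mono_neutral_right) (auto simp: N)
    also have "\<dots> = (if i < q then x i * b j else 0)"
      using m(2)[OF _ j] by (simp add: N e'_def)
    finally show "coeff (f * [:b j:]) i = coeff (\<Sum>l<r. N j l * [:e' l:]) i"
      by (simp only: coeff_const_mult) (simp add: f)
  qed
  \<comment> \<open>transposed, so that its kernel consists of the relations between the products \<open>f b\<^sub>j\<close>\<close>
  define B where "B = mat r r (\<lambda>(l, j). N j l)"
  have B: "B \<in> carrier_mat r r" and Bij: "l < r \<Longrightarrow> j < r \<Longrightarrow> B $$ (l, j) = N j l" for l j
    by (auto simp: B_def)
  define D where "D = det B"

  \<comment> \<open>a kernel vector modulo the maximal ideal yields an element of \<open>F\<^sub>k[t]\<close> annihilated by \<open>f\<close>\<close>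
  have D0: "residue_poly D \<noteq> 0"
  proof
    assume "residue_poly D = 0"
    then have "det (map_mat residue_poly B) = 0" by (simp add: D_def)
    then obtain v where v: "v \<in> carrier_vec r" "v \<noteq> 0\<^sub>v r" "map_mat residue_poly B *\<^sub>v v = 0\<^sub>v r"
      using det_0_iff_vec_prod_zero[of "map_mat residue_poly B" r] B by auto
    define V where "V j = map_poly const_mpoly (v $ j)" for j
    have V: "coeff (V j) i = const_mpoly (coeff (v $ j) i)" for j i
      by (simp add: V_def coeff_map_poly)
    have VA: "V j \<in> polys ?A" for j by (simp add: polys_def V const_mpoly_mem)
    have resV: "residue_poly (V j) = v $ j" for j
      by (simp add: poly_eq_iff coeff_residue_poly V)
    define w where "w = (\<Sum>j<r. V j * [:b j:])"
    have w: "coeff w i = (\<Sum>j<r. const_mpoly (coeff (v $ j) i) * b j)" for i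
      by (simp only: w_def coeff_sum coeff_const_mult V)
    have wk: "coeff w i \<in> F.Ipow k" for i
      unfolding w by (intro F.Ipow(6) F.Ipow(4)[OF const_mpoly_mem] bk) simp
    define Y where "Y l = (\<Sum>j<r. V j * N j l)" for l
    have YA: "Y l \<in> polys ?A" for l
      unfolding Y_def by (intro mpp.sum_mem mpp.mult_mem VA NA) simp
    have "residue_poly (Y l) = 0" if l: "l < r" for l
    proof -
      have "residue_poly (Y l) = (\<Sum>j<r. residue_poly (N j l) * v $ j)"
        by (simp add: Y_def residue.hom_sum residue.hom_mult resV mult.commute)
      also have "\<dots> = (map_mat residue_poly B *\<^sub>v v) $ l"
        using l v(1) B by (simp add: scalar_prod_def Bij atLeast0LessThan)
      finally show ?thesis using v(3) l by simp
    qed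
    then have YM: "coeff (Y l) i \<in> max_ideal n" if "l < r" for l i
      using residue_poly_eq_0_iff[OF YA] that by blast
    have "f * w = (\<Sum>j<r. V j * (f * [:b j:]))"
      by (simp only: w_def sum_distrib_left mult.left_commute)
    also have "\<dots> = (\<Sum>j<r. \<Sum>l<r. V j * (N j l * [:e' l:]))"
      by (intro sum.cong refl) (simp only: fb lessThan_iff sum_distrib_left)
    also have "\<dots> = (\<Sum>l<r. Y l * [:e' l:])"
      by (subst sum.swap) (simp only: Y_def sum_distrib_right mult.assoc)
    finally have "coeff (f * w) i = (\<Sum>l<r. coeff (Y l) i * e' l)" for i
      by (simp only: coeff_sum coeff_const_mult)
    then have "coeff (f * w) i \<in> F.J (Suc k)" for i
      using YM e'k by (simp only:) (intro F.J(6) F.M_mult, auto)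
    then have "coeff w i \<in> F.J k" for i
      unfolding f_def
      using F.mccoy[OF genI F.depth_pos_socle[OF depth[unfolded R_def]] wk] by blast
    then have "coeff (v $ j) i = 0" if "j < r" for i j
      using min_homog_gens_const_relation[OF b _ that, of "\<lambda>j. coeff (v $ j) i"] by (simp only: w)
    then have "v = 0\<^sub>v r" using v(1) by (intro eq_vecI) (auto simp: poly_eq_iff)
    then show False using v(2) by simp
  qed

  show "s = r"
  proof (rule ccontr)
    assume "s \<noteq> r"
    then have s: "s < r" using sr by simp
    have "transpose_mat B *\<^sub>v unit_vec r s = 0\<^sub>v r"
      using s by (intro eq_vecI) (auto simp: B_def N_def scalar_prod_def intro!: sum.neutral)
    then have "det (transpose_mat B) = 0"
      using det_0_iff_vec_prod_zero[of "transpose_mat B" r] B s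
      by (metis transpose_carrier_mat unit_vec_carrier unit_vec_nonzero)
    then show False using D0 B by (simp add: D_def det_transpose)
  qed

  show "height R I \<le> 1"
  proof (cases "primitive_on ?A f")
    case False
    then obtain p where p: "prime_on ?A p" "\<And>i. dvd_on ?A p (coeff f i)"
      by (auto simp: primitive_on_def)
    have px: "dvd_on ?A p (x i)" if "i < q" for i using p(2)[of i] that by (simp add: f)
    have "dvd_on ?A p y" if "y \<in> I" for y
      using that unfolding genI
    proof (induction rule: gen.induct)
      case (step a z y)
      then show ?case using px by (auto intro!: mpd.dvd_add mpd.dvd_mult_left)
    qed (rule mpd.dvd_zero)
    then show ?thesis
      unfolding R_def using mpd.height_le_1_if_prime_dvd[OF factorial_mpolys p(1)] mp.ideal_onD(1)[OF I] by blast
  next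
    case prim: True
    show ?thesis
    proof (cases "\<exists>l<s. e l \<noteq> 0")
      case False
      have zero: "F.Ipow (Suc k) \<subseteq> {0}"
      proof
        fix y assume "y \<in> F.Ipow (Suc k)"
        then have "y \<in> gen ?A (e ` {..<s})" using he by (simp add: homog_gens_def)
        then show "y \<in> {0}"
          by (induction rule: gen.induct) (use False in auto)
      qed
      have pow: "y ^ i \<in> F.Ipow i" if "y \<in> I" for y i
      proof (induction i)
        case 0
        show ?case by (simp add: F.Ipow_0 mp.one_mem)
      next
        case (Suc i)
        then show ?case using F.Ipow_mult_I[OF Suc that] by (simp add: mult.commute)
      qed
      have "I \<subseteq> {0}"
      proof
        fix y assume "y \<in> I"
        then have "y ^ Suc k = 0" using pow[of y "Suc k"] zero by blast
        then show "y \<in> {0}" by auto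
      qed
      then have "I = {0}" using mp.ideal_onD(2)[OF I] by blast
      then show ?thesis by (simp add: R_def mpd.height_zero)
    next
      case True
      then obtain l where l: "l < s" "e l \<noteq> 0" by blast
      have lr: "l < r" using l sr by simp
      define g where "g = (\<Sum>j<r. [:b j:] * adj_mat B $$ (j, l))"
      have adj: "adj_mat B \<in> carrier_mat r r" "B * adj_mat B = D \<cdot>\<^sub>m 1\<^sub>m r"
        using adj_mat[OF B] by (simp_all add: D_def)
      have prod: "(\<Sum>j<r. N j l' * adj_mat B $$ (j, l)) = (if l' = l then D else 0)" if l': "l' < r" for l'
      proof -
        have "(\<Sum>j<r. N j l' * adj_mat B $$ (j, l)) = (B * adj_mat B) $$ (l', l)"
          using B adj(1) l' lr by (simp add: scalar_prod_def Bij atLeast0LessThan)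
        also have "\<dots> = (if l' = l then D else 0)" using adj(2) l' lr by simp
        finally show ?thesis .
      qed
      have "g * f = (\<Sum>j<r. (f * [:b j:]) * adj_mat B $$ (j, l))"
        by (simp only: g_def mult.commute[of _ f] sum_distrib_left mult.assoc)
      also have "\<dots> = (\<Sum>j<r. \<Sum>l'<r. [:e' l':] * (N j l' * adj_mat B $$ (j, l)))"
        by (intro sum.cong refl) (simp only: fb lessThan_iff sum_distrib_right, intro sum.cong refl, simp only: ac_simps)
      also have "\<dots> = (\<Sum>l'<r. [:e' l':] * (\<Sum>j<r. N j l' * adj_mat B $$ (j, l)))"
        by (subst sum.swap) (simp only: sum_distrib_left)
      also have "\<dots> = (\<Sum>l'<r. if l' = l then [:e l:] * D else 0)"
        using l by (intro sum.cong refl) (simp add: prod e'_def)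
      also have "\<dots> = smult (e l) D" using lr by simp
      finally have gf: "smult (e l) D = g * f" by simp
      have DA: "D \<in> polys ?A"
        unfolding D_def by (rule mpp.det_mem[OF B]) (simp add: Bij NA)
      have gA: "g \<in> polys ?A"
        unfolding g_def using F.Ipow(1)[OF bk] lr
        by (intro mpp.sum_mem mpp.mult_mem mp.const_mem mpp.adj_mat_mem[OF B]) (auto simp: Bij NA)
      have "e l \<in> prime_prods ?A"
        using factorial_mpolys l F.Ipow(1)[OF ek] by (auto simp: factorial_on_def)
      then obtain g' where "D = g' * f"
        using mpd.gauss_cancel[OF _ DA gA fA gf prim] by blast
      then have "residue_poly D = 0" using f0 by (simp add: residue.hom_mult)
      then show ?thesis using D0 by simp
    qed
  qed
qed

theorem proposition1p1:
  fixes n :: nat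
    and I :: "((nat \<Rightarrow>\<^sub>0 nat) \<Rightarrow>\<^sub>0 'k::field) set"
  assumes "graded_ideal n I"
    and "I \<noteq> carrier (mpoly_ring n)"
    and "depth (fiber_ring (mpoly_ring n) (graded_max n) I)
           (fiber_ring_plus (mpoly_ring n) (graded_max n) I) > 0"
  shows "(\<forall>k. min_num_gens (mpoly_ring n) (ideal_power (mpoly_ring n) I k)
              \<le> min_num_gens (mpoly_ring n) (ideal_power (mpoly_ring n) I (k + 1))) \<and>
         (height (mpoly_ring n) I \<ge> 2 \<longrightarrow>
           (\<forall>k. min_num_gens (mpoly_ring n) (ideal_power (mpoly_ring n) I k)
                < min_num_gens (mpoly_ring n) (ideal_power (mpoly_ring n) I (k + 1))))"
proof -
  obtain q x where x: "homog_gens n I q x" using graded_ideal_homog_gens[OF assms(1)] by blast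
  have proper: "I \<noteq> mpolys n" using assms(2) by (simp add: mpoly_ring_eq)
  note depth = assms(3)[unfolded mpoly_ring_eq graded_max_eq]
  define \<mu> where "\<mu> k = min_num_gens (mpoly_ring n) (ideal_power (mpoly_ring n) I k)" for k
  have growth: "\<mu> k \<le> \<mu> (Suc k) \<and> (\<mu> (Suc k) \<le> \<mu> k \<longrightarrow> height (mpoly_ring n) I \<le> 1)" for k
  proof -
    have "\<exists>r b. min_homog_gens n (ideal_power (ring_on (mpolys n)) I k) r b" for k
      using homog_gens_Ipow[OF x, of k] min_homog_gens_exists by blast
    then obtain r b s e where b: "min_homog_gens n (ideal_power (ring_on (mpolys n)) I k) r b"
      and e: "min_homog_gens n (ideal_power (ring_on (mpolys n)) I (Suc k)) s e" by metis
    have "\<mu> k = r" "\<mu> (Suc k) = s"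
      using min_num_gens_eq[OF b] min_num_gens_eq[OF e] by (simp_all add: \<mu>_def mpoly_ring_eq)
    then show ?thesis
      using num_gens_growth[OF x proper depth b e] by (cases "s \<le> r") (auto simp: mpoly_ring_eq)
  qed
  have "\<not> \<mu> (Suc k) \<le> \<mu> k" if h: "height (mpoly_ring n) I \<ge> 2" for k
  proof
    assume "\<mu> (Suc k) \<le> \<mu> k"
    then have "2 \<le> (1 :: enat)" using growth[of k] h order_trans by blast
    then show False by simp
  qed
  then show ?thesis using growth by (auto simp: \<mu>_def not_le)
qed

end
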